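(* Let $T,S\in\mathcal{L}(H)$ have the polar decompositions $T=U|T|$ and $S=V|S|$, respectively. Then the following statements are equivalent: (i) $|T|\,|S^*|=|S^*|\,|T|$; (ii) $TS=UV|TS|$ is the polar decomposition of $TS$; (iii) $TS=UV|TS|$.
   Context: $\mathfrak{A}$ is a $C^*$-algebra, $H$ is a (right) Hilbert $\mathfrak{A}$-module, and $\mathcal{L}(H)$ is the $C^*$-algebra of adjointable operators on $H$. For $T\in\mathcal{L}(H)$, $|T|=(T^*T)^{1/2}$, $|T^*|=(TT^* )^{1/2}$, and $\mathcal{R}(T)$ is the range of $T$. A closed submodule $M\subseteq H$ is orthogonally complemented if $H=M\dotplus M^\perp$; then $P_M$ denotes the projection from $H$ onto $M$. An element $W\in\mathcal{L}(H)$ is a partial isometry if $W^*W$ is a projection. "$T=U|T|$ is the polar decomposition of $T$" means: $U\in\mathcal{L}(H)$ is a partial isometry, $T=U|T|$, $\overline{\mathcal{R}(T^* )}$ is orthogonally complemented, and $U^*U=P_{\overline{\mathcal{R}(T^* )}}$. (Such a $U$ is unique when it exists, and it exists if and only if both $\overline{\mathcal{R}(T^* )}$ and $\overline{\mathcal{R}(T)}$ are orthogonally complemented.) *)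

theory Defs
  imports "HOL-Analysis.Analysis"
begin

class complex_banach = banach +
  fixes scaleC :: "complex \<Rightarrow> 'a \<Rightarrow> 'a"  (infixr \<open>*\<^sub>C\<close> 75)
  assumes scaleC_add_right: "c *\<^sub>C (x + y) = c *\<^sub>C x + c *\<^sub>C y"
    and scaleC_add_left: "(c + d) *\<^sub>C x = c *\<^sub>C x + d *\<^sub>C x"
    and scaleC_scaleC: "c *\<^sub>C (d *\<^sub>C x) = (c * d) *\<^sub>C x"
    and scaleC_of_real: "complex_of_real r *\<^sub>C x = r *\<^sub>R x"
    and norm_scaleC: "norm (c *\<^sub>C x) = cmod c * norm x"

text \<open>C*-algebras, not assumed to have a unit.\<close>

class c_star_algebra = complex_banach + real_normed_algebra +
  fixes cstar :: "'a \<Rightarrow> 'a"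
  assumes scaleC_mult_left: "(c *\<^sub>C x) * y = c *\<^sub>C (x * y)"
    and scaleC_mult_right: "x * (c *\<^sub>C y) = c *\<^sub>C (x * y)"
    and cstar_add: "cstar (x + y) = cstar x + cstar y"
    and cstar_scaleC: "cstar (c *\<^sub>C x) = cnj c *\<^sub>C cstar x"
    and cstar_mult: "cstar (x * y) = cstar y * cstar x"
    and cstar_cstar: "cstar (cstar x) = x"
    and norm_cstar_mult_self: "norm (cstar x * x) = (norm x)\<^sup>2"

definition cstar_positive :: "'a::c_star_algebra \<Rightarrow> bool" where
  "cstar_positive a \<longleftrightarrow> (\<exists>b. a = cstar b * b)"

text \<open>Right Hilbert modules \<open>H\<close> over \<open>A\<close>: \<open>ip\<close> is the \<open>A\<close>-valued inner product, linear in the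
  second argument, and \<open>act x a\<close> is \<open>x a\<close>. The norm of the type \<open>'h\<close> is required to be the one
  induced by \<open>ip\<close>; completeness in that norm is then part of the class of \<open>'h\<close>.\<close>

locale hilbert_module =
  fixes ip :: "'h::complex_banach \<Rightarrow> 'h \<Rightarrow> 'a::c_star_algebra"
    and act :: "'h \<Rightarrow> 'a \<Rightarrow> 'h"
  assumes act_add_left: "act (x + y) a = act x a + act y a"
    and act_add_right: "act x (a + b) = act x a + act x b"
    and act_mult: "act x (a * b) = act (act x a) b"
    and act_scaleC_left: "act (c *\<^sub>C x) a = c *\<^sub>C act x a"
    and act_scaleC_right: "act x (c *\<^sub>C a) = c *\<^sub>C act x a"
    and ip_add_right: "ip x (y + z) = ip x y + ip x z"
    and ip_scaleC_right: "ip x (c *\<^sub>C y) = c *\<^sub>C ip x y"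
    and ip_act_right: "ip x (act y a) = ip x y * a"
    and ip_cstar: "ip y x = cstar (ip x y)"
    and ip_positive: "cstar_positive (ip x x)"
    and ip_definite: "ip x x = 0 \<Longrightarrow> x = 0"
    and norm_eq: "norm x = sqrt (norm (ip x x))"

text \<open>The carrier of \<open>L(H)\<close>. A map with an adjoint is automatically linear, bounded and a module
  map.\<close>

definition adjointable :: "('h \<Rightarrow> 'h \<Rightarrow> 'a) \<Rightarrow> ('h \<Rightarrow> 'h) set" where
  "adjointable ip = {T. \<exists>T'. \<forall>x y. ip (T x) y = ip x (T' y)}"

definition adj :: "('h \<Rightarrow> 'h \<Rightarrow> 'a) \<Rightarrow> ('h \<Rightarrow> 'h) \<Rightarrow> 'h \<Rightarrow> 'h" where
  "adj ip T = (THE T'. \<forall>x y. ip (T x) y = ip x (T' y))"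

text \<open>Positivity in the C*-algebra \<open>adjointable ip\<close>, in the same sense as \<^const>\<open>cstar_positive\<close>.\<close>

definition op_positive :: "('h \<Rightarrow> 'h \<Rightarrow> 'a) \<Rightarrow> ('h \<Rightarrow> 'h) \<Rightarrow> bool" where
  "op_positive ip R \<longleftrightarrow> (\<exists>Q\<in>adjointable ip. R = adj ip Q \<circ> Q)"

definition op_sqrt :: "('h \<Rightarrow> 'h \<Rightarrow> 'a) \<Rightarrow> ('h \<Rightarrow> 'h) \<Rightarrow> 'h \<Rightarrow> 'h" where
  "op_sqrt ip P = (THE R. op_positive ip R \<and> R \<circ> R = P)"

definition op_abs :: "('h \<Rightarrow> 'h \<Rightarrow> 'a) \<Rightarrow> ('h \<Rightarrow> 'h) \<Rightarrow> 'h \<Rightarrow> 'h" where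
  "op_abs ip T = op_sqrt ip (adj ip T \<circ> T)"

definition op_projection :: "('h \<Rightarrow> 'h \<Rightarrow> 'a) \<Rightarrow> ('h \<Rightarrow> 'h) \<Rightarrow> bool" where
  "op_projection ip P \<longleftrightarrow> P \<in> adjointable ip \<and> adj ip P = P \<and> P \<circ> P = P"

definition partial_isometry :: "('h \<Rightarrow> 'h \<Rightarrow> 'a) \<Rightarrow> ('h \<Rightarrow> 'h) \<Rightarrow> bool" where
  "partial_isometry ip W \<longleftrightarrow> W \<in> adjointable ip \<and> op_projection ip (adj ip W \<circ> W)"

definition closed_submodule :: "('h::complex_banach \<Rightarrow> 'a \<Rightarrow> 'h) \<Rightarrow> 'h set \<Rightarrow> bool" where
  "closed_submodule act M \<longleftrightarrow> closed M \<and> 0 \<in> M \<and> (\<forall>x\<in>M. \<forall>y\<in>M. x + y \<in> M) \<and>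
     (\<forall>c. \<forall>x\<in>M. c *\<^sub>C x \<in> M) \<and> (\<forall>x\<in>M. \<forall>a. act x a \<in> M)"

definition ortho :: "('h \<Rightarrow> 'h \<Rightarrow> 'a::zero) \<Rightarrow> 'h set \<Rightarrow> 'h set" where
  "ortho ip M = {y. \<forall>x\<in>M. ip x y = 0}"

definition orth_complemented ::
  "('h::complex_banach \<Rightarrow> 'h \<Rightarrow> 'a::zero) \<Rightarrow> ('h \<Rightarrow> 'a \<Rightarrow> 'h) \<Rightarrow> 'h set \<Rightarrow> bool" where
  "orth_complemented ip act M \<longleftrightarrow> closed_submodule act M \<and>
     (\<forall>x. \<exists>m\<in>M. \<exists>n\<in>ortho ip M. x = m + n) \<and> M \<inter> ortho ip M = {0}"

definition proj_onto :: "('h::complex_banach \<Rightarrow> 'h \<Rightarrow> 'a::zero) \<Rightarrow> 'h set \<Rightarrow> 'h \<Rightarrow> 'h" where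
  "proj_onto ip M x = (THE m. m \<in> M \<and> x - m \<in> ortho ip M)"

text \<open>\<open>polar_decomposition ip act U T\<close>: \<open>T = U |T|\<close> is the polar decomposition of \<open>T\<close>.\<close>

definition polar_decomposition ::
  "('h::complex_banach \<Rightarrow> 'h \<Rightarrow> 'a::zero) \<Rightarrow> ('h \<Rightarrow> 'a \<Rightarrow> 'h) \<Rightarrow> ('h \<Rightarrow> 'h) \<Rightarrow> ('h \<Rightarrow> 'h) \<Rightarrow> bool"
where
  "polar_decomposition ip act U T \<longleftrightarrow>
     partial_isometry ip U \<and> T = U \<circ> op_abs ip T \<and>
     orth_complemented ip act (closure (range (adj ip T))) \<and>
     adj ip U \<circ> U = proj_onto ip (closure (range (adj ip T)))"

end

theory Submission
  imports Defs
begin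

text \<open>
  Write \<open>A = |T|\<close>, \<open>B = |S\<^sup>*|\<close>, \<open>P = U\<^sup>* U\<close> and \<open>F = V V\<^sup>*\<close>, so that \<open>T = U A\<close> and \<open>S = B V\<close>, and
  \<open>P\<close> and \<open>F\<close> project along the kernels of \<open>A\<close> and \<open>B\<close>.

  If \<open>A\<close> and \<open>B\<close> commute, then \<open>P\<close> and \<open>F\<close> commute with them and with each other. Hence \<open>V\<^sup>* A B V\<close> is
  positive with square \<open>(T S)\<^sup>* (T S)\<close>, so it is \<open>|T S|\<close>. This gives \<open>U V |T S| = U F A B V = T S\<close>, and
  \<open>V\<^sup>* P V\<close> is the projection onto the closed range of \<open>(T S)\<^sup>*\<close> (\<open>polar_decomposition_if_commute\<close>).
  Conversely, if \<open>T S = U V |T S|\<close>, then \<open>E = V |T S| V\<^sup>*\<close> satisfies \<open>P E = A B\<close> and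
  \<open>E\<^sup>2 = (A B)\<^sup>* (A B) = E P E\<close>. Therefore \<open>E = P E = A B\<close>, and \<open>A B\<close> is self-adjoint
  (\<open>commute_if_factorization\<close>).

  Both directions compute with absolute values, so they need that each \<open>X\<^sup>* X\<close> in \<open>L(H)\<close> has exactly
  one positive square root, and that this root commutes with whatever commutes with \<open>X\<^sup>* X\<close>
  (\<open>positive_root_exists\<close>, \<open>positive_square_root_unique\<close>). The root comes from an iteration
  (\<open>square_root_one_minus\<close>) that converges as soon as \<open>norm (t - X\<^sup>* X) \<le> t\<close> for some \<open>t > 0\<close>. For large \<open>t\<close>
  there is a self-adjoint \<open>c\<close> with \<open>c\<^sup>2 = t - X\<^sup>* X\<close>, and
  \<open>t ip x x = ip (c x) (c x) + ip (X x) (X x)\<close>. The bound thus reduces to one property of the coefficient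
  algebra: \<open>norm a \<le> norm (a + b)\<close> for positive \<open>a\<close> and \<open>b\<close>
  (\<open>norm_le_norm_add_cstar_positive\<close>).

  That property contains the classical theorem that \<open>b\<^sup>* b\<close> has nonnegative spectrum. It is proved
  without spectral theory, using the adjointable operators of the algebra acting on itself by left
  multiplication: there the same iteration supplies square roots, and \<open>negative_square_zero\<close> takes the
  place of the comparison of the spectra of \<open>Y\<^sup>* Y\<close> and \<open>Y Y\<^sup>*\<close>.
\<close>

section \<open>The bounded operators of a Banach space as a Banach algebra\<close>

text \<open>A copy of \<open>'h \<Rightarrow>\<^sub>L 'h\<close>, so that composition can be the multiplication of a type class. The
  identity may be \<open>0\<close> here (when the space is trivial), hence \<^class>\<open>monoid_mult\<close> below instead of a
  class that makes \<open>0 \<noteq> 1\<close>.\<close>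

typedef (overloaded) 'h endo = "UNIV :: ('h::real_normed_vector \<Rightarrow>\<^sub>L 'h) set" ..

setup_lifting type_definition_endo

lift_definition app :: "'h::real_normed_vector endo \<Rightarrow> 'h \<Rightarrow> 'h" (infixr "\<cdot>" 90) is blinfun_apply .

instantiation endo :: (real_normed_vector) real_normed_algebra
begin
lift_definition norm_endo :: "'a endo \<Rightarrow> real" is norm .
lift_definition minus_endo :: "'a endo \<Rightarrow> 'a endo \<Rightarrow> 'a endo" is minus .
lift_definition plus_endo :: "'a endo \<Rightarrow> 'a endo \<Rightarrow> 'a endo" is plus .
lift_definition uminus_endo :: "'a endo \<Rightarrow> 'a endo" is uminus .
lift_definition zero_endo :: "'a endo" is 0 .
lift_definition scaleR_endo :: "real \<Rightarrow> 'a endo \<Rightarrow> 'a endo" is scaleR .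
lift_definition times_endo :: "'a endo \<Rightarrow> 'a endo \<Rightarrow> 'a endo" is blinfun_compose .
definition dist_endo :: "'a endo \<Rightarrow> 'a endo \<Rightarrow> real"
  where "dist_endo S T = norm (S - T)"
definition sgn_endo :: "'a endo \<Rightarrow> 'a endo"
  where "sgn_endo T = inverse (norm T) *\<^sub>R T"
definition uniformity_endo :: "('a endo \<times> 'a endo) filter"
  where "uniformity_endo = (INF e\<in>{0<..}. principal {(x, y). dist x y < e})"
definition open_endo :: "'a endo set \<Rightarrow> bool"
  where "open_endo S = (\<forall>x\<in>S. \<forall>\<^sub>F (x', y) in uniformity. x' = x \<longrightarrow> y \<in> S)"
instance
  by standard (rule dist_endo_def sgn_endo_def uniformity_endo_def open_endo_def
    | (transfer; auto simp: algebra_simps norm_triangle_ineq norm_blinfun_compose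
        blinfun.bilinear_simps intro: blinfun_eqI))+
end

instantiation endo :: (real_normed_vector) monoid_mult
begin
lift_definition one_endo :: "'a endo" is id_blinfun .
instance by standard (transfer; auto intro: blinfun_eqI)+
end

lemma dist_endo_Rep: "dist S T = dist (Rep_endo S) (Rep_endo T)"
  unfolding dist_norm by transfer simp

instance endo :: (banach) banach
proof
  fix X :: "nat \<Rightarrow> 'a endo"
  assume "Cauchy X"
  then have "Cauchy (\<lambda>n. Rep_endo (X n))"
    unfolding Cauchy_def dist_endo_Rep .
  then obtain L where "(\<lambda>n. Rep_endo (X n)) \<longlonglongrightarrow> L"
    using Cauchy_convergent_iff convergent_def by blast
  then have "X \<longlonglongrightarrow> Abs_endo L"
    unfolding tendsto_iff dist_endo_Rep by (simp add: Abs_endo_inverse)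
  then show "convergent X"
    by (rule convergentI)
qed

lemma endo_eqI: "(\<And>x. S \<cdot> x = T \<cdot> x) \<Longrightarrow> S = T"
  by transfer (rule blinfun_eqI)

lemma app_simps [simp]:
  "(S + T) \<cdot> x = S \<cdot> x + T \<cdot> x" "(S - T) \<cdot> x = S \<cdot> x - T \<cdot> x" "(- S) \<cdot> x = - (S \<cdot> x)"
  "(r *\<^sub>R S) \<cdot> x = r *\<^sub>R (S \<cdot> x)" "(S * T) \<cdot> x = S \<cdot> T \<cdot> x" "1 \<cdot> x = x" "0 \<cdot> x = 0"
  by (transfer; simp add: blinfun.bilinear_simps)+

lemma bounded_bilinear_app: "bounded_bilinear (\<cdot>)"
proof
  show "\<exists>K. \<forall>(a::'a endo) b. norm (a \<cdot> b) \<le> norm a * norm b * K"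
    by (rule exI[of _ 1], transfer) (simp add: norm_blinfun)
qed (simp_all, (transfer, simp add: blinfun.bilinear_simps)+)

interpretation app: bounded_bilinear "(\<cdot>)"
  by (rule bounded_bilinear_app)

lemma norm_app: "norm (T \<cdot> x) \<le> norm T * norm x"
  by transfer (rule norm_blinfun)

lemma norm_endo_bound: "0 \<le> b \<Longrightarrow> (\<And>x. norm (T \<cdot> x) \<le> b * norm x) \<Longrightarrow> norm T \<le> b"
  by transfer (rule norm_blinfun_bound)

lemma endo_of_bounded_linear:
  assumes "bounded_linear f"
  obtains T where "\<And>x. T \<cdot> x = f x"
proof
  show "Abs_endo (Blinfun f) \<cdot> x = f x" for x
    by (simp add: app.rep_eq Abs_endo_inverse bounded_linear_Blinfun_apply assms)
qed

lemma norm_one_le: "norm (1 :: 'h::real_normed_vector endo) \<le> 1"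
  by (rule norm_endo_bound) auto

section \<open>Square roots by iteration\<close>

text \<open>Writing the root of \<open>1 - B\<close> as \<open>1 - S\<close> turns the equation into the fixed point problem
  \<open>S = (B + S\<^sup>2) / 2\<close>. Iterating from \<open>0\<close>, the steps are dominated by those of the same
  iteration in the reals with \<open>B = 1\<close>, which increases and stays below \<open>1\<close>; so the iteration
  converges even for \<open>norm B = 1\<close>, where no contraction argument applies. Every closed property that
  the iteration preserves passes to \<open>S\<close>. In this way \<open>S\<close> inherits from \<open>B\<close> both self-adjointness
  and the operators with which it commutes.\<close>

lemma square_root_one_minus:
  fixes B :: "'b::{real_normed_algebra, monoid_mult, banach}"
  assumes B: "norm B \<le> 1"
  obtains S where "norm S \<le> 1" "(1 - S) * (1 - S) = 1 - B"
    "\<And>C. closed C \<Longrightarrow> 0 \<in> C \<Longrightarrow> (\<And>s. s \<in> C \<Longrightarrow> (1/2) *\<^sub>R (B + s * s) \<in> C) \<Longrightarrow> S \<in> C"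
proof -
  define f where "f s = (1/2) *\<^sub>R (B + s * s)" for s
  define g where "g (s::real) = (1 + s * s) / 2" for s
  define X where "X n = (f ^^ n) 0" for n
  define y where "y n = (g ^^ n) 0" for n
  have X0: "X 0 = 0" and XS: "X (Suc n) = f (X n)" for n by (simp_all add: X_def)
  have y0: "y 0 = 0" and yS: "y (Suc n) = g (y n)" for n by (simp_all add: y_def)
  have in_C: "X n \<in> C" if "0 \<in> C" "\<And>s. s \<in> C \<Longrightarrow> f s \<in> C" for C n
    by (induction n) (auto simp: X0 XS that)
  have sq_comm: "C * f s = f s * C" if "C * B = B * C" "C * s = s * C" for C s
  proof -
    have "C * (s * s) = s * s * C" using that(2) by (metis mult.assoc)
    with that(1) show ?thesis by (simp add: f_def distrib_left distrib_right)
  qed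
  have comm1: "B * X n = X n * B" for n
    using in_C[of "{s. B * s = s * B}"] sq_comm[of B] by simp
  have comm: "X m * X n = X n * X m" for m n
    using in_C[of "{s. X m * s = s * X m}"] sq_comm[of "X m"] comm1[of m] by simp
  have y_bds: "0 \<le> y n \<and> y n \<le> 1" for n
  proof (induction n)
    case (Suc n)
    then have "y n * y n \<le> 1 * 1" by (intro mult_mono) auto
    with Suc show ?case by (simp add: yS g_def)
  qed (simp add: y0)
  have normX: "norm (X n) \<le> y n" for n
  proof (induction n)
    case (Suc n)
    have "norm (X n * X n) \<le> norm (X n) * norm (X n)" by (rule norm_mult_ineq)
    also have "\<dots> \<le> y n * y n" using Suc y_bds[of n] by (intro mult_mono) auto
    finally have "norm (B + X n * X n) \<le> 1 + y n * y n"
      using B norm_triangle_ineq[of B "X n * X n"] by linarith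
    then show ?case by (simp add: XS yS f_def g_def)
  qed (simp add: X0 y0)
  have step: "norm (X (Suc n) - X n) \<le> y (Suc n) - y n" for n
  proof (induction n)
    case 0
    show ?case using B by (simp add: X0 XS y0 yS f_def g_def)
  next
    case (Suc n)
    have "X (Suc (Suc n)) - X (Suc n) = (1/2) *\<^sub>R ((X (Suc n) - X n) * (X (Suc n) + X n))"
    proof -
      have "f a - f b = (1/2) *\<^sub>R ((a - b) * (a + b))" if "b * a = a * b" for a b
        by (simp add: f_def algebra_simps that)
      from this[OF comm[of n "Suc n"]] show ?thesis by (simp only: XS)
    qed
    also have "norm \<dots> \<le> (1/2) * (norm (X (Suc n) - X n) * norm (X (Suc n) + X n))"
      by (simp add: norm_mult_ineq)
    also have "\<dots> \<le> (1/2) * ((y (Suc n) - y n) * (y (Suc n) + y n))"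
      using Suc y_bds[of n] y_bds[of "Suc n"] normX[of n] normX[of "Suc n"]
        norm_triangle_ineq[of "X (Suc n)" "X n"] norm_ge_zero[of "X (Suc n) - X n"]
      by (intro mult_left_mono mult_mono) (linarith | simp)+
    also have "\<dots> = y (Suc (Suc n)) - y (Suc n)"
    proof -
      have "2 * y (Suc n) = 1 + y n * y n" "2 * y (Suc (Suc n)) = 1 + y (Suc n) * y (Suc n)"
        using yS[of n] yS[of "Suc n"] by (simp_all add: g_def)
      then show ?thesis by (simp add: algebra_simps)
    qed
    finally show ?case .
  qed
  have tele: "norm (X (n + k) - X n) \<le> y (n + k) - y n" for n k
  proof (induction k)
    case (Suc k)
    have "norm (X (n + Suc k) - X n) \<le> norm (X (Suc (n + k)) - X (n + k)) + norm (X (n + k) - X n)"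
      using norm_triangle_ineq[of "X (Suc (n + k)) - X (n + k)" "X (n + k) - X n"] by simp
    with Suc step[of "n + k"] show ?case by simp
  qed simp
  have "incseq y"
  proof (rule incseq_SucI)
    show "y n \<le> y (Suc n)" for n
      using step[of n] norm_ge_zero[of "X (Suc n) - X n"] by linarith
  qed
  then have "convergent y"
    using y_bds by (auto intro!: Bseq_monoseq_convergent BseqI'[of _ 1] incseq_imp_monoseq)
  then have "Cauchy y" by (simp add: Cauchy_convergent_iff)
  have "Cauchy X"
  proof (rule CauchyI')
    fix e :: real assume "e > 0"
    then obtain M where M: "\<And>m n. m \<ge> M \<Longrightarrow> n \<ge> M \<Longrightarrow> norm (y m - y n) < e"
      using CauchyD[OF \<open>Cauchy y\<close>] by metis
    have "dist (X m) (X n) < e" if mn: "m \<ge> M" "n > m" for m n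
    proof -
      obtain k where "n = m + k" using mn(2) less_imp_add_positive by blast
      then show ?thesis
        using M[of n m] tele[of m k] that by (simp add: dist_norm norm_minus_commute)
    qed
    then show "\<exists>M. \<forall>m\<ge>M. \<forall>n>m. dist (X m) (X n) < e" by blast
  qed
  then obtain S where S: "X \<longlonglongrightarrow> S" using Cauchy_convergent_iff convergent_def by blast
  have fS: "f S = S"
  proof (rule LIMSEQ_unique)
    show "(\<lambda>n. X (Suc n)) \<longlonglongrightarrow> S" using S by (rule LIMSEQ_Suc)
    show "(\<lambda>n. X (Suc n)) \<longlonglongrightarrow> f S" unfolding XS f_def by (intro tendsto_intros S)
  qed
  show ?thesis
  proof
    show "norm S \<le> 1"
      by (rule LIMSEQ_le_const2[OF tendsto_norm[OF S]]) (meson normX y_bds order_trans)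
    have "S + S = B + S * S" using arg_cong[OF fS, of "\<lambda>u. u + u"] 
      by (simp add: f_def flip: scaleR_left_distrib)
    then have "B = S + S - S * S" by (simp add: eq_diff_eq)
    then show "(1 - S) * (1 - S) = 1 - B" by (simp add: left_diff_distrib right_diff_distrib)
    show "S \<in> C" if "closed C" "0 \<in> C" "\<And>s. s \<in> C \<Longrightarrow> (1/2) *\<^sub>R (B + s * s) \<in> C" for C
      using closed_sequentially[OF that(1) _ S] in_C[of C] that by (auto simp: f_def)
  qed
qed

section \<open>Adjoints on a Hilbert module\<close>

lemma scaleC_minus1: "(-1) *\<^sub>C x = - (x::'a::complex_banach)"
  using scaleC_of_real[of "-1" x] by simp

lemma bounded_linear_scaleC: "bounded_linear (\<lambda>x::'a::complex_banach. c *\<^sub>C x)"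
proof
  show "c *\<^sub>C (r *\<^sub>R x) = r *\<^sub>R (c *\<^sub>C x)" for r and x :: 'a
    by (simp add: mult.commute scaleC_scaleC flip: scaleC_of_real)
  show "\<exists>K. \<forall>x::'a. norm (c *\<^sub>C x) \<le> norm x * K"
    by (rule exI[of _ "cmod c"]) (simp add: norm_scaleC)
qed (rule scaleC_add_right)

lemma norm_cstar: "norm (cstar a) = norm (a::'a::c_star_algebra)"
proof -
  have le: "norm a \<le> norm (cstar a)" for a :: 'a
  proof (cases "a = 0")
    case False
    have "norm a * norm a \<le> norm (cstar a) * norm a"
      using norm_mult_ineq[of "cstar a" a] norm_cstar_mult_self[of a] by (simp add: power2_eq_square)
    with False show ?thesis by simp
  qed simp
  show ?thesis using le[of a] le[of "cstar a"] by (simp add: cstar_cstar)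
qed

context hilbert_module
begin

lemma ip_add_left: "ip (x + y) z = ip x z + ip y z"
  by (metis ip_cstar ip_add_right cstar_add)

lemma ip_scaleC_left: "ip (c *\<^sub>C x) y = cnj c *\<^sub>C ip x y"
  by (metis ip_cstar ip_scaleC_right cstar_scaleC)

lemma ip_scaleR_right: "ip x (r *\<^sub>R y) = r *\<^sub>R ip x y"
  using ip_scaleC_right[of x "of_real r" y] by (simp add: scaleC_of_real)

lemma ip_scaleR_left: "ip (r *\<^sub>R x) y = r *\<^sub>R ip x y"
  using ip_scaleC_left[of "of_real r" x y] by (simp add: scaleC_of_real)

lemma norm_ip_self: "norm (ip x x) = (norm x)\<^sup>2"
  using norm_eq[of x] by simp

text \<open>Polarization and the triangle inequality of the given norm yield the Cauchy-Schwarz inequality up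
  to the constant \<open>4\<close>, which is enough for continuity of the inner product. The usual proof of the sharp
  inequality would presuppose the order of the coefficient algebra, which is only treated below.\<close>

lemma norm_ip_weak: "norm (ip x y) \<le> 4 * (norm x * norm y)"
proof -
  have minus_right: "ip u (- v) = - ip u v" and minus_left: "ip (- u) v = - ip u v" for u v
    using ip_scaleR_right[of u "-1" v] ip_scaleR_left[of "-1" u v] by simp_all
  have re: "norm (ip u v + ip v u) \<le> (norm u + norm v)\<^sup>2" for u v
  proof -
    have "2 *\<^sub>R (ip u v + ip v u) = ip (u + v) (u + v) - ip (u + - v) (u + - v)"
      by (simp only: ip_add_left ip_add_right minus_right minus_left) (simp add: scaleR_2)
    then have "2 * norm (ip u v + ip v u) = norm (ip (u + v) (u + v) - ip (u + - v) (u + - v))"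
      by (metis norm_scaleR abs_numeral)
    also have "\<dots> \<le> (norm (u + v))\<^sup>2 + (norm (u + - v))\<^sup>2"
      using norm_triangle_ineq4 by (simp only: flip: norm_ip_self)
    also have "\<dots> \<le> (norm u + norm v)\<^sup>2 + (norm u + norm v)\<^sup>2"
      using norm_triangle_ineq[of u v] norm_triangle_ineq[of u "- v"]
      by (intro add_mono power_mono) auto
    finally show ?thesis by simp
  qed
  have unscaled: "norm (ip u v) \<le> (norm u + norm v)\<^sup>2" for u v
  proof -
    have "norm (ip u v - ip v u) = norm (\<i> *\<^sub>C (ip u v - ip v u))"
      by (simp add: norm_scaleC)
    also have "\<i> *\<^sub>C (ip u v - ip v u) = ip u (\<i> *\<^sub>C v) + ip (\<i> *\<^sub>C v) u"
      using scaleC_add_right[of \<i> "ip u v" "- ip v u"] scaleC_scaleC[of \<i> "-1" "ip v u"]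
      by (simp add: ip_scaleC_left ip_scaleC_right scaleC_minus1)
    also have "norm \<dots> \<le> (norm u + norm v)\<^sup>2"
      using re[of u "\<i> *\<^sub>C v"] by (simp add: norm_scaleC)
    finally have im: "norm (ip u v - ip v u) \<le> (norm u + norm v)\<^sup>2" .
    have "2 * norm (ip u v) = norm ((ip u v + ip v u) + (ip u v - ip v u))"
      by (simp flip: scaleR_2)
    also have "\<dots> \<le> 2 * (norm u + norm v)\<^sup>2"
      using norm_triangle_ineq[of "ip u v + ip v u" "ip u v - ip v u"] re[of u v] im by linarith
    finally show ?thesis by simp
  qed
  show ?thesis
  proof (cases "x = 0 \<or> y = 0")
    case True
    then show ?thesis
      using ip_scaleR_left[of 0 x y] ip_scaleR_right[of x 0 y] by auto
  next
    case False
    define u where "u = x /\<^sub>R norm x"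
    define v where "v = y /\<^sub>R norm y"
    have uv: "norm u = 1" "norm v = 1" using False by (simp_all add: u_def v_def)
    have "ip x y = (norm x * norm y) *\<^sub>R ip u v"
      using False by (simp add: u_def v_def ip_scaleR_left ip_scaleR_right field_simps)
    then have "norm (ip x y) = norm (ip u v) * (norm x * norm y)" by (simp add: mult.commute)
    also have "\<dots> \<le> 4 * (norm x * norm y)"
      using unscaled[of u v] uv by (intro mult_right_mono) auto
    finally show ?thesis .
  qed
qed

lemma bounded_bilinear_ip: "bounded_bilinear ip"
proof
  show "\<exists>K. \<forall>a b. norm (ip a b) \<le> norm a * norm b * K"
    using norm_ip_weak by (intro exI[of _ 4]) (simp add: mult.commute)
qed (simp_all add: ip_add_left ip_add_right ip_scaleR_left ip_scaleR_right)

sublocale ip: bounded_bilinear ip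
  by (rule bounded_bilinear_ip)

lemma ip_eqI: "(\<And>z. ip z x = ip z y) \<Longrightarrow> x = y"
  using ip_definite[of "x - y"] by (simp add: ip.diff_right)

text \<open>Working with a named adjoint instead of the function \<^const>\<open>adj\<close> keeps the definite description
  out of all computations.\<close>

definition adjoint_pair :: "('h \<Rightarrow> 'h) \<Rightarrow> ('h \<Rightarrow> 'h) \<Rightarrow> bool" where
  "adjoint_pair T T' \<longleftrightarrow> (\<forall>x y. ip (T x) y = ip x (T' y))"

lemma adjoint_pairD: "adjoint_pair T T' \<Longrightarrow> ip (T x) y = ip x (T' y)"
  by (simp add: adjoint_pair_def)

lemma adjoint_pair_sym: "adjoint_pair T T' \<Longrightarrow> adjoint_pair T' T"
  by (metis adjoint_pair_def ip_cstar)

text \<open>Moving \<open>T\<close> to the other side of the inner product leaves the linear structure exposed, and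
  the inner product separates points.\<close>

lemma
  assumes "adjoint_pair T T'"
  shows adjoint_pair_add: "T (x + y) = T x + T y"
    and adjoint_pair_scaleC: "T (c *\<^sub>C x) = c *\<^sub>C T x"
    and adjoint_pair_act: "T (act x a) = act (T x) a"
proof -
  have move: "ip z (T x) = ip (T' z) x" for z x
    by (rule adjoint_pairD[OF adjoint_pair_sym[OF assms], symmetric])
  show "T (x + y) = T x + T y" by (rule ip_eqI) (simp add: ip_add_right move)
  show "T (c *\<^sub>C x) = c *\<^sub>C T x" by (rule ip_eqI) (simp add: ip_scaleC_right move)
  show "T (act x a) = act (T x) a" by (rule ip_eqI) (simp add: ip_act_right move)
qed

abbreviation adjoint_endos :: "'h endo \<Rightarrow> 'h endo \<Rightarrow> bool" where
  "adjoint_endos T T' \<equiv> adjoint_pair ((\<cdot>) T) ((\<cdot>) T')"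

abbreviation selfadjoint :: "'h endo \<Rightarrow> bool" where
  "selfadjoint T \<equiv> adjoint_endos T T"

lemma adjoint_endos_intros:
  "adjoint_endos 1 1" "adjoint_endos 0 0"
  "adjoint_endos S S' \<Longrightarrow> adjoint_endos (r *\<^sub>R S) (r *\<^sub>R S')" "adjoint_endos S S' \<Longrightarrow> adjoint_endos (- S) (- S')"
  "adjoint_endos S S' \<Longrightarrow> adjoint_endos T T' \<Longrightarrow> adjoint_endos (S + T) (S' + T')"
  "adjoint_endos S S' \<Longrightarrow> adjoint_endos T T' \<Longrightarrow> adjoint_endos (S - T) (S' - T')"
  "adjoint_endos S S' \<Longrightarrow> adjoint_endos T T' \<Longrightarrow> adjoint_endos (S * T) (T' * S')"
  by (simp_all add: adjoint_pair_def ip.add_left ip.add_right ip.diff_left ip.diff_right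
      ip.scaleR_left ip.scaleR_right ip.minus_left ip.minus_right ip.zero_left ip.zero_right)

lemma selfadjoint_mult: "selfadjoint S \<Longrightarrow> selfadjoint T \<Longrightarrow> S * T = T * S \<Longrightarrow> selfadjoint (S * T)"
  using adjoint_endos_intros(7)[of S S T T] by simp

lemma closed_selfadjoint: "closed {T. selfadjoint T}"
  unfolding adjoint_pair_def
  by (intro closed_Collect_all closed_Collect_eq ip.continuous_on app.continuous_on
      continuous_on_id continuous_on_const)

lemma closed_commuting: "closed {T. X * T = T * (X :: 'h endo)}"
  by (intro closed_Collect_eq continuous_intros)

text \<open>The root is \<open>sqrt t (1 - S)\<close> with \<open>S\<close> the fixed point for \<open>1 - T / t\<close>. The third conclusion has the
  form of the hypothesis, so the construction can be applied again to the root; this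
  is how positivity of the root is obtained.\<close>

lemma selfadjoint_square_root:
  assumes T: "selfadjoint T" and t: "t > 0" "norm (t *\<^sub>R 1 - T) \<le> t"
  obtains c where "selfadjoint c" "c * c = T" "norm (sqrt t *\<^sub>R 1 - c) \<le> sqrt t"
    "\<And>X. X * T = T * X \<Longrightarrow> X * c = c * X"
proof -
  define B where "B = 1 - (1/t) *\<^sub>R T"
  have "B = (1/t) *\<^sub>R (t *\<^sub>R 1 - T)" using t by (simp add: B_def scaleR_diff_right)
  then have "norm B = (1/t) * norm (t *\<^sub>R 1 - T)" using t by simp
  also have "\<dots> \<le> 1" using t by simp
  finally have "norm B \<le> 1" .
  then obtain S where S: "norm S \<le> 1" "(1 - S) * (1 - S) = 1 - B"
    "\<And>C. closed C \<Longrightarrow> 0 \<in> C \<Longrightarrow> (\<And>s. s \<in> C \<Longrightarrow> (1/2) *\<^sub>R (B + s * s) \<in> C) \<Longrightarrow> S \<in> C"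
    using square_root_one_minus by blast
  have saB: "selfadjoint B" unfolding B_def by (intro adjoint_endos_intros T)
  have "S \<in> {T. selfadjoint T}"
    by (rule S(3)[OF closed_selfadjoint]) (simp_all add: adjoint_endos_intros saB)
  then have saS: "selfadjoint S" by simp
  define c where "c = sqrt t *\<^sub>R (1 - S)"
  show ?thesis
  proof
    show "selfadjoint c" unfolding c_def by (intro adjoint_endos_intros saS)
    have "c * c = t *\<^sub>R ((1 - S) * (1 - S))" using t by (simp add: c_def)
    also have "\<dots> = T" unfolding S(2) using t by (simp add: B_def)
    finally show "c * c = T" .
    show "norm (sqrt t *\<^sub>R 1 - c) \<le> sqrt t"
      using t S(1) by (simp add: c_def scaleR_diff_right mult_left_le)
    fix X assume X: "X * T = T * X"
    then have XB: "X * B = B * X" by (simp add: B_def right_diff_distrib left_diff_distrib)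
    have "S \<in> {T. X * T = T * X}"
    proof (rule S(3)[OF closed_commuting])
      fix s assume "s \<in> {T. X * T = T * X}"
      then have "X * s = s * X" by simp
      then have "X * (s * s) = s * s * X" by (metis mult.assoc)
      with XB show "(1/2) *\<^sub>R (B + s * s) \<in> {T. X * T = T * X}"
        by (simp add: distrib_left distrib_right)
    qed simp
    then show "X * c = c * X" by (simp add: c_def right_diff_distrib left_diff_distrib)
  qed
qed

text \<open>The C*-algebra arguments need the complex unit as an operator, to form \<open>h + i k\<close>.\<close>

lemma multiplication_by_i:
  obtains J :: "'h endo" where "J * J = - 1" "adjoint_endos J (- J)" "norm J \<le> 1"
    "\<And>T T'. adjoint_endos T T' \<Longrightarrow> J * T = T * J"
proof -
  obtain J :: "'h endo" where J: "\<And>x. J \<cdot> x = \<i> *\<^sub>C x"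
    using endo_of_bounded_linear[OF bounded_linear_scaleC] by blast
  show ?thesis
  proof
    show "J * J = - 1" by (rule endo_eqI) (simp add: J scaleC_scaleC scaleC_minus1)
    have "(- \<i>) *\<^sub>C x = - (\<i> *\<^sub>C x)" for x :: 'a
      using scaleC_scaleC[of "-1" \<i> x] by (simp add: scaleC_minus1)
    then show "adjoint_endos J (- J)"
      by (simp add: adjoint_pair_def J ip.minus_right ip_scaleC_left ip_scaleC_right)
    show "norm J \<le> 1" by (rule norm_endo_bound) (simp_all add: J norm_scaleC)
    show "J * T = T * J" if "adjoint_endos T T'" for T T'
      by (rule endo_eqI) (simp add: J adjoint_pair_scaleC[OF that])
  qed
qed

end

section \<open>Positivity in the algebra of adjointable operators\<close>

text \<open>With the sharp Cauchy-Schwarz inequality the adjointable operators satisfy the C*-identity for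
  the operator norm. A C*-algebra, seen as a Hilbert module over itself, is of this kind, and its
  adjointable operators provide the unit that the algebra itself may lack.\<close>

locale hilbert_module_cs = hilbert_module ip act
  for ip :: "'h::complex_banach \<Rightarrow> 'h \<Rightarrow> 'a::c_star_algebra" and act +
  assumes norm_ip_le: "norm (ip x y) \<le> norm x * norm y"
begin

lemma norm_square_le:
  assumes "adjoint_endos T T'"
  shows "(norm T)\<^sup>2 \<le> norm (T' * T)"
proof -
  have "norm (T \<cdot> x) \<le> sqrt (norm (T' * T)) * norm x" for x
  proof -
    have "(norm (T \<cdot> x))\<^sup>2 = norm (ip x ((T' * T) \<cdot> x))"
      using adjoint_pairD[OF assms, of x "T \<cdot> x"] by (simp flip: norm_ip_self)
    also have "\<dots> \<le> norm x * norm ((T' * T) \<cdot> x)" by (rule norm_ip_le)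
    also have "\<dots> \<le> norm x * (norm (T' * T) * norm x)" by (intro mult_left_mono norm_app) simp
    also have "\<dots> = (sqrt (norm (T' * T)) * norm x)\<^sup>2" by (simp add: power2_eq_square)
    finally show ?thesis by (rule power2_le_imp_le) simp
  qed
  then have "norm T \<le> sqrt (norm (T' * T))" by (intro norm_endo_bound) auto
  then show ?thesis using sqrt_ge_absD by force
qed

lemma norm_adjoint_le:
  assumes "adjoint_endos T T'"
  shows "norm T \<le> norm T'"
proof (cases "T = 0")
  case False
  have "norm T * norm T \<le> norm T' * norm T"
    using norm_square_le[OF assms] norm_mult_ineq[of T' T] by (simp add: power2_eq_square)
  with False show ?thesis by simp
qed simp

text \<open>Since \<open>(h + i k)\<^sup>* (h + i k) = h\<^sup>2 + k\<^sup>2\<close>, the norms of \<open>h + i k\<close> and of \<open>h - i k\<close> are at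
  most the root of \<open>norm (h\<^sup>2 + k\<^sup>2)\<close>, and \<open>k\<close> is a combination of the two.\<close>

lemma norm_le_sum_of_commuting_squares:
  assumes h: "selfadjoint h" and k: "selfadjoint k" and comm: "h * k = k * h"
  shows "(norm k)\<^sup>2 \<le> norm (h * h + k * k)"
proof -
  obtain J :: "'h endo" where J: "J * J = - 1" "adjoint_endos J (- J)" "norm J \<le> 1"
    "\<And>T T'. adjoint_endos T T' \<Longrightarrow> J * T = T * J"
    using multiplication_by_i by metis
  let ?m = "norm (h * h + k * k)"
  define l where "l = J * k"
  have l: "adjoint_endos l (- l)"
    using adjoint_endos_intros(7)[OF J(2) k] J(4)[OF k] by (simp add: l_def)
  have hl: "h * l = l * h"
    using J(4)[OF h] comm unfolding l_def by (metis mult.assoc)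
  have ll: "l * l = - (k * k)"
  proof -
    have "l * l = J * (k * J) * k" by (simp add: l_def mult.assoc)
    also have "\<dots> = (J * J) * (k * k)" unfolding J(4)[OF k, symmetric] by (simp add: mult.assoc)
    finally show ?thesis by (simp add: J(1))
  qed
  have "adjoint_endos (h + l) (h - l)" using adjoint_endos_intros(5)[OF h l] by simp
  from norm_square_le[OF this] have p: "(norm (h + l))\<^sup>2 \<le> ?m"
    by (simp add: algebra_simps hl ll)
  have "adjoint_endos (h - l) (h + l)" using adjoint_endos_intros(6)[OF h l] by simp
  from norm_square_le[OF this] have q: "(norm (h - l))\<^sup>2 \<le> ?m"
    by (simp add: algebra_simps hl ll)
  have "2 *\<^sub>R l = (h + l) - (h - l)" by (simp add: scaleR_2)
  then have "2 * norm l \<le> norm (h + l) + norm (h - l)"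
    by (metis norm_scaleR abs_numeral norm_triangle_ineq4)
  also have "\<dots> \<le> 2 * sqrt ?m"
    using p q real_le_rsqrt by (smt (verit))
  finally have "norm l \<le> sqrt ?m" by simp
  moreover have "norm k \<le> norm l"
  proof -
    have "k = - (J * l)" using J(1) by (simp add: l_def flip: mult.assoc)
    then have "norm k \<le> norm J * norm l" by (metis norm_minus_cancel norm_mult_ineq)
    also have "\<dots> \<le> norm l" using J(3) by (simp add: mult_left_le_one_le)
    finally show ?thesis .
  qed
  ultimately have "norm k \<le> sqrt ?m" by simp
  then show ?thesis using sqrt_ge_absD by force
qed

text \<open>For a self-adjoint \<open>T\<close>, the existence of such a \<open>t\<close> says that the spectrum is nonnegative.
  In this form positivity is visibly preserved by sums, which is hard to see for
  squares or for elements \<open>b\<^sup>* b\<close>; the lemmas below identify the three notions.\<close>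

definition pos :: "'h endo \<Rightarrow> bool" where
  "pos T \<longleftrightarrow> selfadjoint T \<and> (\<exists>t. norm (t *\<^sub>R 1 - T) \<le> t)"

lemma posI: "selfadjoint T \<Longrightarrow> norm (t *\<^sub>R 1 - T) \<le> t \<Longrightarrow> pos T"
  by (auto simp: pos_def)

lemma pos_selfadjoint: "pos T \<Longrightarrow> selfadjoint T"
  by (simp add: pos_def)

lemma norm_scaleR_one_le: "t \<ge> 0 \<Longrightarrow> norm (t *\<^sub>R (1::'h endo)) \<le> t"
  by (simp add: norm_one_le mult_left_le)

lemma pos_root:
  assumes "pos T"
  obtains c where "pos c" "c * c = T" "\<And>X. X * T = T * X \<Longrightarrow> X * c = c * X"
proof -
  obtain t where t: "selfadjoint T" "norm (t *\<^sub>R 1 - T) \<le> t" using assms by (auto simp: pos_def)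
  then have "t \<ge> 0" using norm_ge_zero[of "t *\<^sub>R 1 - T"] by linarith
  show ?thesis
  proof (cases "t = 0")
    case True
    with t have "T = 0" by simp
    moreover have "pos 0" by (rule posI[of _ 0]) (simp_all add: adjoint_endos_intros)
    ultimately show ?thesis using that[of 0] by simp
  next
    case False
    with \<open>t \<ge> 0\<close> have "t > 0" by simp
    from selfadjoint_square_root[OF t(1) this t(2)] obtain c where c: "selfadjoint c" "c * c = T"
      "norm (sqrt t *\<^sub>R 1 - c) \<le> sqrt t" "\<And>X. X * T = T * X \<Longrightarrow> X * c = c * X"
      by metis
    show ?thesis using posI[OF c(1,3)] c(2,4) by (rule that)
  qed
qed

text \<open>The operator \<open>t - h\<^sup>2\<close> is positive because \<open>norm (h\<^sup>2) \<le> t\<close>. Its root \<open>k\<close> commutes with \<open>h\<close> and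
  satisfies \<open>h\<^sup>2 + k\<^sup>2 = t\<close>, so \<open>norm (k\<^sup>2) \<le> t\<close>.\<close>

lemma norm_diff_square_le:
  assumes h: "selfadjoint h" and t: "norm (h * h) \<le> t"
  shows "norm (t *\<^sub>R 1 - h * h) \<le> t"
proof -
  have "pos (t *\<^sub>R 1 - h * h)"
    by (rule posI[of _ t]) (use t in \<open>simp_all add: adjoint_endos_intros h\<close>)
  then obtain k where k: "pos k" "k * k = t *\<^sub>R 1 - h * h"
    "\<And>X. X * (t *\<^sub>R 1 - h * h) = (t *\<^sub>R 1 - h * h) * X \<Longrightarrow> X * k = k * X"
    using pos_root by blast
  have "h * k = k * h" by (rule k(3)) (simp add: algebra_simps)
  from norm_le_sum_of_commuting_squares[OF h pos_selfadjoint[OF k(1)] this]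
  have "(norm k)\<^sup>2 \<le> norm (t *\<^sub>R (1 :: 'h endo))" by (simp add: k(2))
  also have "\<dots> \<le> t" using order_trans[OF norm_ge_zero t] by (rule norm_scaleR_one_le)
  finally show ?thesis
    using norm_mult_ineq[of k k] by (simp add: power2_eq_square flip: k(2))
qed

lemma pos_square: "selfadjoint h \<Longrightarrow> pos (h * h)"
  by (rule posI[OF selfadjoint_mult norm_diff_square_le]) auto

lemma pos_add:
  assumes "pos a" "pos b"
  shows "pos (a + b)"
proof -
  obtain s t where "norm (s *\<^sub>R 1 - a) \<le> s" "norm (t *\<^sub>R 1 - b) \<le> t"
    using assms by (auto simp: pos_def)
  then have "norm ((s + t) *\<^sub>R 1 - (a + b)) \<le> s + t"
    using norm_triangle_ineq[of "s *\<^sub>R 1 - a" "t *\<^sub>R 1 - b"] by (simp add: scaleR_left_distrib algebra_simps)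
  moreover have "selfadjoint (a + b)" by (intro adjoint_endos_intros pos_selfadjoint assms)
  ultimately show ?thesis by (rule posI[rotated])
qed

lemma pos_scaleR:
  assumes "pos a" "r \<ge> 0"
  shows "pos (r *\<^sub>R a)"
proof -
  obtain t where "norm (t *\<^sub>R 1 - a) \<le> t" using assms by (auto simp: pos_def)
  then have "norm (r *\<^sub>R (t *\<^sub>R 1 - a)) \<le> r * t" using assms(2) by (simp add: mult_left_mono)
  moreover have "selfadjoint (r *\<^sub>R a)" by (intro adjoint_endos_intros pos_selfadjoint assms)
  ultimately show ?thesis by (intro posI[of _ "r * t"]) (simp_all add: scaleR_diff_right)
qed

text \<open>With \<open>t = norm (a + b)\<close>, the operator \<open>t - a = (t - (a + b)) + b\<close> is positive. So \<open>a = c\<^sup>2\<close> and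
  \<open>t - a = d\<^sup>2\<close> for commuting roots whose squares add up to \<open>t\<close>.\<close>

lemma norm_le_add_pos:
  assumes a: "pos a" and b: "pos b"
  shows "norm a \<le> norm (a + b)"
proof -
  let ?t = "norm (a + b)"
  have "pos (?t *\<^sub>R 1 - (a + b))"
    by (rule posI[of _ ?t]) (simp_all add: adjoint_endos_intros pos_selfadjoint a b add.commute)
  from pos_add[OF this b] have "pos (?t *\<^sub>R 1 - a)" by simp
  then obtain d where d: "pos d" "d * d = ?t *\<^sub>R 1 - a"
    "\<And>X. X * (?t *\<^sub>R 1 - a) = (?t *\<^sub>R 1 - a) * X \<Longrightarrow> X * d = d * X"
    using pos_root by blast
  obtain c where c: "pos c" "c * c = a" using pos_root[OF a] by blast
  have "d * c = c * d"
    by (rule d(3)[symmetric]) (simp add: algebra_simps flip: c(2))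
  from norm_le_sum_of_commuting_squares[OF pos_selfadjoint[OF d(1)] pos_selfadjoint[OF c(1)] this]
  have "(norm c)\<^sup>2 \<le> norm (?t *\<^sub>R (1 :: 'h endo))" by (simp add: c d)
  also have "\<dots> \<le> ?t" by (rule norm_scaleR_one_le) simp
  finally show ?thesis using norm_mult_ineq[of c c] c(2) by (simp add: power2_eq_square)
qed

lemma selfadjoint_nilpotent: "selfadjoint p \<Longrightarrow> p * p = 0 \<Longrightarrow> p = 0"
  using norm_square_le[of p p] by simp

text \<open>The core of the theorem that \<open>b\<^sup>* b\<close> is positive. Spectral theory would argue that \<open>Y\<^sup>* Y\<close> and \<open>Y Y\<^sup>*\<close>
  have the same nonzero spectrum, while the first is negative and the second, being
  \<open>2 (h\<^sup>2 + k\<^sup>2) - Y\<^sup>* Y\<close> for the real and imaginary parts of \<open>Y\<close>, is positive. The spectrum is avoided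
  by comparing norms: with \<open>m = Y Y\<^sup>*\<close> and \<open>t = norm m\<close>,
  \<open>m (t + m)\<^sup>2 = Y (t - z\<^sup>2)\<^sup>2 Y\<^sup>*\<close>.
  Here the right side has norm at most \<open>t\<^sup>3\<close>, whereas the left side dominates \<open>2 t m\<^sup>2\<close>, of norm
  \<open>2 t\<^sup>3\<close>. Hence \<open>t = 0\<close>.\<close>

lemma negative_square_zero:
  assumes Y: "adjoint_endos Y Y'" and z: "selfadjoint z" and neg: "Y' * Y = - (z * z)"
  shows "Y = 0"
proof -
  obtain J :: "'h endo" where J: "J * J = - 1" "adjoint_endos J (- J)" "norm J \<le> 1"
    "\<And>T T'. adjoint_endos T T' \<Longrightarrow> J * T = T * J"
    using multiplication_by_i by metis
  note Y' = adjoint_pair_sym[OF Y]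
  \<comment> \<open>\<open>h\<close> and \<open>k\<close> are, up to sign, the real and imaginary parts of \<open>Y\<close>.\<close>
  define h where "h = (1/2) *\<^sub>R (Y + Y')"
  define D where "D = (1/2) *\<^sub>R (Y - Y')"
  define k where "k = J * D"
  define m where "m = Y * Y'"
  have h: "selfadjoint h"
    using adjoint_endos_intros(3)[OF adjoint_endos_intros(5)[OF Y Y']] by (simp add: h_def add.commute)
  have D: "adjoint_endos D (- D)"
    using adjoint_endos_intros(3)[OF adjoint_endos_intros(6)[OF Y Y'], of "1/2"]
    by (simp add: D_def flip: scaleR_minus_right)
  have k: "selfadjoint k"
    using adjoint_endos_intros(7)[OF J(2) D] J(4)[OF D] by (simp add: k_def)
  have "k * k = - (D * D)"
  proof -
    have "k * k = J * (D * J) * D" by (simp add: k_def mult.assoc)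
    also have "\<dots> = (J * J) * (D * D)" unfolding J(4)[OF D, symmetric] by (simp add: mult.assoc)
    finally show ?thesis by (simp add: J(1))
  qed
  then have "2 *\<^sub>R (h * h + k * k) = (1/2) *\<^sub>R ((Y + Y') * (Y + Y') - (Y - Y') * (Y - Y'))"
  proof -
    have "h * h = (1/4) *\<^sub>R ((Y + Y') * (Y + Y'))" "D * D = (1/4) *\<^sub>R ((Y - Y') * (Y - Y'))"
      by (simp_all add: h_def D_def)
    with \<open>k * k = - (D * D)\<close> show ?thesis by (simp add: scaleR_diff_right)
  qed
  also have "(Y + Y') * (Y + Y') - (Y - Y') * (Y - Y') = 2 *\<^sub>R (Y * Y' + Y' * Y)"
    by (simp add: scaleR_2 algebra_simps)
  finally have "2 *\<^sub>R (h * h + k * k) = Y * Y' + Y' * Y" by simp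
  then have "m = 2 *\<^sub>R (h * h + k * k) + z * z" by (simp add: m_def neg)
  then have pos_m: "pos m" using h k z by (simp add: pos_add pos_scaleR pos_square)
  define t where "t = norm m"
  have "t \<ge> 0" by (simp add: t_def)
  have "(norm Y')\<^sup>2 \<le> t" using norm_square_le[OF Y'] by (simp add: t_def m_def)
  then have YY: "norm Y * norm Y' \<le> t"
    using norm_adjoint_le[OF Y] mult_right_mono[of "norm Y" "norm Y'" "norm Y'"]
    by (simp add: power2_eq_square)
  have "norm (z * z) \<le> t"
    using norm_mult_ineq[of Y' Y] YY unfolding neg by (simp add: mult.commute)
  from norm_diff_square_le[OF z this] have q: "norm (t *\<^sub>R 1 + Y' * Y) \<le> t" by (simp add: neg)
  let ?q = "t *\<^sub>R 1 + Y' * Y"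
  have "norm (Y * (?q * (?q * Y'))) \<le> norm Y * (norm ?q * (norm ?q * norm Y'))"
    by (meson norm_mult_ineq mult_left_mono norm_ge_zero order_trans)
  also have "\<dots> \<le> norm Y * (t * (t * norm Y'))"
    using q \<open>t \<ge> 0\<close> by (intro mult_left_mono mult_mono) auto
  also have "\<dots> = (norm Y * norm Y') * (t * t)" by simp
  also have "\<dots> \<le> t * (t * t)" using YY by (intro mult_right_mono) auto
  finally have upper: "norm (Y * (?q * (?q * Y'))) \<le> t * (t * t)" .
  obtain w where w: "pos w" "w * w = m" using pos_root[OF pos_m] by blast
  \<comment> \<open>\<open>m\<^sup>3\<close> is a square, because \<open>m = w\<^sup>2\<close>.\<close>
  have "pos ((m * w) * (m * w))"
    by (intro pos_square selfadjoint_mult pos_selfadjoint pos_m w) (simp add: mult.assoc flip: w(2))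
  moreover have "(m * w) * (m * w) = m * m * m" by (simp add: mult.assoc flip: w(2))
  ultimately have "pos ((t * t) *\<^sub>R m + m * m * m)"
    using pos_add pos_scaleR[OF pos_m, of "t * t"] by simp
  moreover have "pos ((2 * t) *\<^sub>R (m * m))"
    using \<open>t \<ge> 0\<close> by (intro pos_scaleR pos_square pos_selfadjoint pos_m) auto
  ultimately have "norm ((2 * t) *\<^sub>R (m * m)) \<le> norm ((2 * t) *\<^sub>R (m * m) + ((t * t) *\<^sub>R m + m * m * m))"
    by (intro norm_le_add_pos)
  also have "(2 * t) *\<^sub>R (m * m) + ((t * t) *\<^sub>R m + m * m * m) = Y * (?q * (?q * Y'))"
    by (simp only: mult_2 scaleR_left_distrib) (simp add: m_def distrib_left distrib_right mult.assoc scaleR_right_distrib)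
  finally have "2 * t * norm (m * m) \<le> t * (t * t)" using upper \<open>t \<ge> 0\<close> by simp
  moreover have "t * t \<le> norm (m * m)"
    using norm_square_le[OF pos_selfadjoint[OF pos_m]] by (simp add: t_def power2_eq_square)
  ultimately have "2 * t * (t * t) \<le> t * (t * t)"
    using \<open>t \<ge> 0\<close> mult_left_mono[of "t * t" "norm (m * m)" "2 * t"] by linarith
  then have "t * (t * t) \<le> 0" by simp
  then have "t = 0" using \<open>t \<ge> 0\<close> by (metis mult_eq_0_iff mult_nonneg_nonneg order_antisym)
  with \<open>(norm Y')\<^sup>2 \<le> t\<close> norm_adjoint_le[OF Y] show ?thesis by simp
qed

text \<open>Let \<open>a = b\<^sup>* b\<close> and let \<open>f\<close> be the root of \<open>a\<^sup>2\<close>, the absolute value of \<open>a\<close>. Then \<open>p = f - a\<close> is twice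
  the negative part of \<open>a\<close>, and \<open>(b p)\<^sup>* (b p) = p a p = - f p\<^sup>2\<close> is the negative of a square. So
  \<open>b p = 0\<close>, which forces \<open>p = 0\<close> and \<open>a = f\<close>.\<close>

lemma pos_adjoint_mult:
  assumes b: "adjoint_endos b b'"
  shows "pos (b' * b)"
proof -
  define a where "a = b' * b"
  have sa_a: "selfadjoint a" unfolding a_def by (intro adjoint_endos_intros b adjoint_pair_sym[OF b])
  obtain f where f: "pos f" "f * f = a * a" "\<And>X. X * (a * a) = a * a * X \<Longrightarrow> X * f = f * X"
    using pos_root[OF pos_square[OF sa_a]] by blast
  have af: "a * f = f * a" by (rule f(3)) (simp add: mult.assoc)
  obtain g where g: "pos g" "g * g = f" "\<And>X. X * f = f * X \<Longrightarrow> X * g = g * X"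
    using pos_root[OF f(1)] by blast
  define p where "p = f - a"
  have sa_p: "selfadjoint p" unfolding p_def by (intro adjoint_endos_intros pos_selfadjoint f sa_a)
  have pf: "p * f = f * p" using af by (simp add: p_def algebra_simps)
  have pg: "p * g = g * p" by (rule g(3)[OF pf])
  have ap: "a * p = - (f * p)" using af f(2) by (simp add: p_def algebra_simps)
  have Y: "adjoint_endos (b * p) (p * b')" by (intro adjoint_endos_intros b sa_p)
  have zz: "(g * p) * (g * p) = f * p * p" using pg g(2) by (metis mult.assoc)
  have "(p * b') * (b * p) = p * (a * p)" by (simp add: a_def mult.assoc)
  also have "\<dots> = - ((g * p) * (g * p))" unfolding zz ap using pf by (simp flip: mult.assoc)
  finally have "b * p = 0"
    by (rule negative_square_zero[OF Y selfadjoint_mult[OF pos_selfadjoint[OF g(1)] sa_p pg[symmetric]]])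
  then have "a * p = 0" by (simp add: a_def mult.assoc)
  with ap have "p * p = 0" by (simp add: p_def[THEN arg_cong, of "\<lambda>u. u * p"] left_diff_distrib)
  then have "p = 0" by (rule selfadjoint_nilpotent[OF sa_p])
  then show ?thesis using f(1) by (simp add: p_def a_def)
qed

end

section \<open>The positive cone of a C*-algebra\<close>

interpretation self_module: hilbert_module_cs "\<lambda>x y. cstar x * y" "\<lambda>x a. x * (a::'a::c_star_algebra)"
proof
  fix x y :: 'a and c
  show "cstar y * x = cstar (cstar x * y)" by (simp add: cstar_mult cstar_cstar)
  show "cstar_positive (cstar x * x)" by (auto simp: cstar_positive_def)
  show "cstar x * x = 0 \<Longrightarrow> x = 0" using norm_cstar_mult_self[of x] by simp
  show "norm x = sqrt (norm (cstar x * x))" by (simp add: norm_cstar_mult_self)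
  show "norm (cstar x * y) \<le> norm x * norm y" using norm_mult_ineq[of "cstar x" y] by (simp add: norm_cstar)
qed (simp_all add: algebra_simps scaleC_mult_left scaleC_mult_right)

text \<open>Left multiplication embeds the algebra isometrically into the adjointable operators of the
  algebra over itself, where \<open>b\<^sup>* b\<close> is known to be positive.\<close>

lemma norm_le_norm_add_cstar_positive:
  fixes a b :: "'a::c_star_algebra"
  assumes "cstar_positive a" "cstar_positive b"
  shows "norm a \<le> norm (a + b)"
proof -
  have ex: "\<forall>a::'a. \<exists>L. \<forall>x. L \<cdot> x = a * x"
    using endo_of_bounded_linear[OF bounded_linear_mult_right] by metis
  obtain L :: "'a \<Rightarrow> 'a endo" where L: "\<And>a x. L a \<cdot> x = a * x"
    using choice[OF ex] by blast
  have pos: "self_module.pos (L (cstar c * c))" for c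
  proof -
    have "self_module.adjoint_endos (L c) (L (cstar c))"
      by (simp add: self_module.adjoint_pair_def L cstar_mult mult.assoc)
    then have "self_module.pos (L (cstar c) * L c)" by (rule self_module.pos_adjoint_mult)
    also have "L (cstar c) * L c = L (cstar c * c)" by (rule endo_eqI) (simp add: L mult.assoc)
    finally show ?thesis .
  qed
  \<comment> \<open>In the absence of a unit, \<open>L a\<close> is tested on \<open>cstar a\<close>.\<close>
  have norm_le: "norm a \<le> norm (L a)" for a
  proof (cases "a = 0")
    case False
    have "norm (a * cstar a) = norm a * norm a"
      using norm_cstar_mult_self[of "cstar a"] by (simp add: cstar_cstar norm_cstar power2_eq_square)
    then have "norm a * norm a \<le> norm (L a) * norm a"
      using norm_app[of "L a" "cstar a"] by (simp add: L norm_cstar)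
    with False show ?thesis by simp
  qed simp
  have "norm a \<le> norm (L a)" by (rule norm_le)
  also have "\<dots> \<le> norm (L a + L b)"
    using assms pos by (intro self_module.norm_le_add_pos) (auto simp: cstar_positive_def)
  also have "\<dots> \<le> norm (a + b)"
    by (rule norm_endo_bound) (simp_all add: L norm_mult_ineq flip: distrib_right)
  finally show ?thesis .
qed

section \<open>Bounded adjoints and positive square roots on a Hilbert module\<close>

context hilbert_module
begin

text \<open>The inner product values are positive elements of the coefficient algebra, so the monotonicity
  of the norm on the cone turns a decomposition of \<open>ip x x\<close> into a norm estimate.\<close>

lemma norm_le_of_ip_sum:
  assumes "ip x x = ip y y + ip z z"
  shows "norm y \<le> norm x"
  using norm_le_norm_add_cstar_positive[OF ip_positive ip_positive, of y z]
  by (simp add: norm_eq assms)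

lemma ip_sum_zero:
  assumes "ip x x + ip y y = 0"
  shows "x = 0"
  using norm_le_of_ip_sum[of 0 x y] assms by (simp add: ip.zero_left)

lemma adjoint_pair_comp:
  "adjoint_pair S S' \<Longrightarrow> adjoint_pair T T' \<Longrightarrow> adjoint_pair (S \<circ> T) (T' \<circ> S')"
  by (simp add: adjoint_pair_def)

lemma adjoint_pair_diff: "adjoint_pair T T' \<Longrightarrow> T (x - y) = T x - T y"
  using adjoint_pair_add[of T T' "x - y" y] by simp

lemma adjoint_pair_zero: "adjoint_pair T T' \<Longrightarrow> T 0 = 0"
  using adjoint_pair_diff[of T T' 0 0] by simp

lemma adjoint_unique: "adjoint_pair T T' \<Longrightarrow> adjoint_pair T T'' \<Longrightarrow> T' x = T'' x"
  by (rule ip_eqI) (metis adjoint_pairD)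

text \<open>A Banach-Steinhaus argument: the functionals \<open>x \<mapsto> ip x (T' y)\<close> with \<open>norm y \<le> 1\<close> are continuous, and at
  each \<open>x\<close> they are bounded, by a multiple of \<open>norm (T x)\<close>. By Baire they are uniformly
  bounded on a ball, and for \<open>y = T z / norm (T z)\<close> the value at \<open>z\<close> has norm \<open>norm (T z)\<close>.\<close>

lemma adjoint_pair_bounded_linear:
  assumes T: "adjoint_pair T T'"
  shows "bounded_linear T"
proof -
  have scaleR: "T (r *\<^sub>R x) = r *\<^sub>R T x" for r x
    using adjoint_pair_scaleC[OF T, of "of_real r" x] by (simp add: scaleC_of_real)
  define F where "F n = {x. \<forall>y. norm y \<le> 1 \<longrightarrow> norm (ip x (T' y)) \<le> real n}" for n :: nat
  have closed_F: "closed (F n)" for n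
    unfolding F_def
    by (intro closed_Collect_all closed_Collect_imp closed_Collect_le open_Collect_const
        continuous_on_norm ip.continuous_on continuous_on_id continuous_on_const)
  have "\<exists>n. x \<in> F n" for x
  proof -
    obtain n :: nat where n: "4 * norm (T x) \<le> real n" using real_arch_simple by blast
    have "norm (ip x (T' y)) \<le> real n" if "norm y \<le> 1" for y
    proof -
      have "norm (ip x (T' y)) \<le> 4 * (norm (T x) * norm y)"
        using norm_ip_weak[of "T x" y] by (simp add: adjoint_pairD[OF T])
      also have "\<dots> \<le> 4 * norm (T x)" using that by (simp add: mult_left_le)
      finally show ?thesis using n by simp
    qed
    then show ?thesis by (auto simp: F_def)
  qed
  then have union: "(\<Union>n. F n) = UNIV" by auto
  have "\<exists>n. interior (F n) \<noteq> {}"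
  proof (rule ccontr)
    assume "\<not> ?thesis"
    then have "euclidean interior_of \<Union> (range F) = {}"
      using closed_F by (intro Baire_category_alt) (auto simp: completely_metrizable_space_euclidean)
    with union show False by simp
  qed
  then obtain n x0 where "x0 \<in> interior (F n)" by blast
  then obtain r where r: "r > 0" "ball x0 r \<subseteq> F n" by (meson mem_interior)
  have small: "norm (T z) \<le> 2 * real n" if z: "norm z < r" for z
  proof (cases "T z = 0")
    case False
    define y where "y = T z /\<^sub>R norm (T z)"
    have y: "norm y \<le> 1" using False by (simp add: y_def)
    have "x0 + z \<in> F n" "x0 \<in> F n" using z r by (auto simp: dist_norm)
    then have "norm (ip (x0 + z) (T' y)) \<le> n" "norm (ip x0 (T' y)) \<le> n"
      using y by (auto simp: F_def)
    moreover have "ip z (T' y) = ip (x0 + z) (T' y) - ip x0 (T' y)" by (simp add: ip.add_left)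
    ultimately have "norm (ip z (T' y)) \<le> 2 * real n"
      using norm_triangle_ineq4[of "ip (x0 + z) (T' y)" "ip x0 (T' y)"] by simp
    moreover have "norm (ip z (T' y)) = norm (T z)"
      using False
      by (simp add: adjoint_pairD[OF T, symmetric] y_def ip.scaleR_right norm_ip_self power2_eq_square)
    ultimately show ?thesis by simp
  qed simp
  show ?thesis
  proof (rule bounded_linear_intro)
    show "T (x + y) = T x + T y" for x y by (rule adjoint_pair_add[OF T])
    show "T (c *\<^sub>R x) = c *\<^sub>R T x" for c x by (rule scaleR)
    fix x
    show "norm (T x) \<le> norm x * (4 * real n / r)"
    proof (cases "x = 0")
      case True
      then show ?thesis using adjoint_pair_zero[OF T] by simp
    next
      case False
      define c where "c = r / (2 * norm x)"
      have "c > 0" using False r by (simp add: c_def)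
      have "norm (c *\<^sub>R x) < r" using False r by (simp add: c_def)
      from small[OF this] have "c * norm (T x) \<le> 2 * real n"
        using \<open>c > 0\<close> by (simp add: scaleR)
      then have "norm (T x) \<le> 2 * real n / c" using \<open>c > 0\<close> by (simp add: field_simps)
      also have "\<dots> = norm x * (4 * real n / r)" using False r by (simp add: c_def field_simps)
      finally show ?thesis .
    qed
  qed
qed

lemma adjoint_pair_continuous: "adjoint_pair T T' \<Longrightarrow> continuous_on X T"
  by (rule linear_continuous_on[OF adjoint_pair_bounded_linear])

lemma adjoint_pair_endo:
  assumes "adjoint_pair T T'"
  obtains E where "(\<cdot>) E = T"
proof -
  obtain E where E: "E \<cdot> x = T x" for x
    using endo_of_bounded_linear[OF adjoint_pair_bounded_linear[OF assms]] by blast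
  show ?thesis by (rule that[of E]) (simp add: fun_eq_iff E)
qed

text \<open>For \<open>t > norm (X\<^sup>* X)\<close> the operator \<open>t - X\<^sup>* X\<close> has a self-adjoint root \<open>c\<close>, and
  \<open>ip (c x) (c x) + ip (X x) (X x) = t ip x x\<close>. Hence \<open>norm c \<le> sqrt t\<close> and \<open>norm (c\<^sup>2) \<le> t\<close>. So
  \<open>X\<^sup>* X\<close> satisfies the hypothesis of the square root construction.\<close>

lemma norm_diff_adjoint_mult:
  assumes X: "adjoint_endos X X'"
  obtains t where "t > 0" "norm (t *\<^sub>R 1 - X' * X) \<le> t"
proof -
  define t where "t = norm (X' * X) + 1"
  have "t > 0" by (simp add: t_def add_nonneg_pos)
  have "selfadjoint (t *\<^sub>R 1 - X' * X)" by (intro adjoint_endos_intros X adjoint_pair_sym[OF X])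
  moreover have "norm (t *\<^sub>R 1 - (t *\<^sub>R 1 - X' * X)) \<le> t" by (simp add: t_def)
  ultimately obtain c where c: "selfadjoint c" "c * c = t *\<^sub>R 1 - X' * X"
    by (rule selfadjoint_square_root[OF _ \<open>t > 0\<close>])
  have "norm (c \<cdot> x) \<le> sqrt t * norm x" for x
  proof -
    have "ip (c \<cdot> x) (c \<cdot> x) = ip x ((c * c) \<cdot> x)" by (simp add: adjoint_pairD[OF c(1)])
    also have "\<dots> = t *\<^sub>R ip x x - ip (X \<cdot> x) (X \<cdot> x)"
      by (simp add: c(2) ip.diff_right ip.scaleR_right adjoint_pairD[OF X])
    finally have "ip (sqrt t *\<^sub>R x) (sqrt t *\<^sub>R x) = ip (c \<cdot> x) (c \<cdot> x) + ip (X \<cdot> x) (X \<cdot> x)"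
      using \<open>t > 0\<close> by (simp add: ip.scaleR_left ip.scaleR_right)
    from norm_le_of_ip_sum[OF this] show ?thesis using \<open>t > 0\<close> by simp
  qed
  then have "norm c \<le> sqrt t" using \<open>t > 0\<close> by (intro norm_endo_bound) auto
  then have "norm c * norm c \<le> sqrt t * sqrt t" by (intro mult_mono) (use \<open>t > 0\<close> in auto)
  with norm_mult_ineq[of c c] \<open>t > 0\<close> have "norm (c * c) \<le> t" by simp
  with \<open>t > 0\<close> show ?thesis by (intro that[of t]) (simp_all add: c(2))
qed

text \<open>A fourth root \<open>W\<close> of \<open>X\<^sup>* X\<close>: its square is then a root of the form \<open>Q\<^sup>* Q\<close> with \<open>Q = W\<close>, as positivity
  demands. The commutation property is what uniqueness of the root and positivity of
  commuting products rest on.\<close>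

lemma positive_root_exists:
  assumes X: "adjoint_pair X X'"
  obtains W where "adjoint_pair W W" "(W \<circ> W) \<circ> (W \<circ> W) = X' \<circ> X"
    "\<And>C C'. adjoint_pair C C' \<Longrightarrow> C \<circ> (X' \<circ> X) = (X' \<circ> X) \<circ> C \<Longrightarrow> C \<circ> W = W \<circ> C"
proof -
  obtain Y where Y: "(\<cdot>) Y = X" using adjoint_pair_endo[OF X] .
  obtain Y' where Y': "(\<cdot>) Y' = X'" using adjoint_pair_endo[OF adjoint_pair_sym[OF X]] .
  have adjY: "adjoint_endos Y Y'" using X by (simp add: Y Y')
  have comp: "(\<cdot>) (E * F) = (\<cdot>) E \<circ> (\<cdot>) F" for E F :: "'h endo" by auto
  obtain t where t: "t > 0" "norm (t *\<^sub>R 1 - Y' * Y) \<le> t" using norm_diff_adjoint_mult[OF adjY] .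
  have "selfadjoint (Y' * Y)" by (intro adjoint_endos_intros adjY adjoint_pair_sym[OF adjY])
  from selfadjoint_square_root[OF this t] obtain R where R: "selfadjoint R" "R * R = Y' * Y"
    "norm (sqrt t *\<^sub>R 1 - R) \<le> sqrt t" "\<And>Z. Z * (Y' * Y) = Y' * Y * Z \<Longrightarrow> Z * R = R * Z"
    by metis
  have "sqrt t > 0" using t by simp
  from selfadjoint_square_root[OF R(1) this R(3)] obtain W where W: "selfadjoint W" "W * W = R"
    "\<And>Z. Z * R = R * Z \<Longrightarrow> Z * W = W * Z"
    by metis
  show ?thesis
  proof
    show "adjoint_pair ((\<cdot>) W) ((\<cdot>) W)" by (rule W(1))
    have "((\<cdot>) W \<circ> (\<cdot>) W) \<circ> ((\<cdot>) W \<circ> (\<cdot>) W) = (\<cdot>) ((W * W) * (W * W))" by auto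
    also have "\<dots> = X' \<circ> X" by (simp only: W(2) R(2) comp Y Y')
    finally show "((\<cdot>) W \<circ> (\<cdot>) W) \<circ> ((\<cdot>) W \<circ> (\<cdot>) W) = X' \<circ> X" .
    fix C C' assume C: "adjoint_pair C C'" and comm: "C \<circ> (X' \<circ> X) = (X' \<circ> X) \<circ> C"
    obtain Z where Z: "(\<cdot>) Z = C" using adjoint_pair_endo[OF C] .
    have "Z * (Y' * Y) = Y' * Y * Z"
    proof (rule endo_eqI)
      show "(Z * (Y' * Y)) \<cdot> x = (Y' * Y * Z) \<cdot> x" for x
        using fun_cong[OF comm, of x] by (simp add: Y Y' Z)
    qed
    then have "Z * W = W * Z" by (intro W(3) R(4))
    then have "(\<cdot>) (Z * W) = (\<cdot>) (W * Z)" by simp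
    then show "C \<circ> (\<cdot>) W = (\<cdot>) W \<circ> C" by (simp only: comp Z)
  qed
qed

lemma adj_eq: "adjoint_pair T T' \<Longrightarrow> adj ip T = T'"
  unfolding adj_def adjoint_pair_def[symmetric]
  by (rule the_equality) (auto intro: adjoint_unique)

lemma adjointable_iff: "T \<in> adjointable ip \<longleftrightarrow> (\<exists>T'. adjoint_pair T T')"
  by (simp add: adjointable_def adjoint_pair_def)

lemma adjointable_adj: "T \<in> adjointable ip \<Longrightarrow> adjoint_pair T (adj ip T)"
  using adj_eq adjointable_iff by metis

lemma op_positive_iff: "op_positive ip R \<longleftrightarrow> (\<exists>Q Q'. adjoint_pair Q Q' \<and> R = Q' \<circ> Q)"
  unfolding op_positive_def using adjointable_adj adj_eq adjointable_iff by metis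

lemma op_positive_selfadjoint: "op_positive ip R \<Longrightarrow> adjoint_pair R R"
  unfolding op_positive_iff using adjoint_pair_comp adjoint_pair_sym by blast

lemma op_positive_square: "adjoint_pair W W \<Longrightarrow> op_positive ip (W \<circ> W)"
  unfolding op_positive_iff by blast

lemma op_positive_conj:
  assumes "op_positive ip R" "adjoint_pair X X'"
  shows "op_positive ip (X' \<circ> R \<circ> X)"
proof -
  obtain Q Q' where Q: "adjoint_pair Q Q'" "R = Q' \<circ> Q" using assms(1) op_positive_iff by blast
  have "X' \<circ> R \<circ> X = (X' \<circ> Q') \<circ> (Q \<circ> X)" by (simp add: Q comp_assoc)
  with adjoint_pair_comp[OF Q(1) assms(2)] show ?thesis unfolding op_positive_iff by blast
qed

text \<open>Every positive root \<open>R\<close> of \<open>X\<^sup>* X\<close> commutes with \<open>W\<close>. For \<open>y = (R - W\<^sup>2) v\<close> therefore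
  \<open>(W\<^sup>2 + R) y = (R\<^sup>2 - W\<^sup>4) v = 0\<close>, so the two positive elements \<open>ip y (W\<^sup>2 y)\<close> and \<open>ip y (R y)\<close> have sum
  zero and both vanish. This yields \<open>(R - W\<^sup>2)\<^sup>2 = 0\<close>, and \<open>R - W\<^sup>2\<close> is self-adjoint.\<close>

lemma positive_square_root_unique:
  assumes X: "adjoint_pair X X'"
    and R: "op_positive ip R" "R \<circ> R = X' \<circ> X"
    and R2: "op_positive ip R2" "R2 \<circ> R2 = X' \<circ> X"
  shows "R = R2"
proof -
  obtain W where W: "adjoint_pair W W" "(W \<circ> W) \<circ> (W \<circ> W) = X' \<circ> X"
    "\<And>C C'. adjoint_pair C C' \<Longrightarrow> C \<circ> (X' \<circ> X) = (X' \<circ> X) \<circ> C \<Longrightarrow> C \<circ> W = W \<circ> C"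
    using positive_root_exists[OF X] by blast
  have eq: "R x = W (W x)" if R: "op_positive ip R" and RR: "R \<circ> R = X' \<circ> X" for R x
  proof -
    note saR = op_positive_selfadjoint[OF R]
    obtain Q Q' where Q: "adjoint_pair Q Q'" "R = Q' \<circ> Q" using R op_positive_iff by blast
    have "R \<circ> W = W \<circ> R" by (rule W(3)[OF saR]) (simp add: comp_assoc flip: RR)
    then have RW: "R (W x) = W (R x)" for x by (simp add: fun_eq_iff)
    have sq: "R (R x) = W (W (W (W x)))" for x
      using fun_cong[OF RR[folded W(2)], of x] by simp
    define y where "y v = R v - W (W v)" for v
    have sum_zero: "ip (W (y v)) (W (y v)) + ip (Q (y v)) (Q (y v)) = 0" for v
    proof -
      have "ip (W (y v)) (W (y v)) + ip (Q (y v)) (Q (y v)) = ip (y v) (W (W (y v)) + R (y v))"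
        by (simp add: adjoint_pairD[OF W(1)] adjoint_pairD[OF Q(1)] Q(2) ip.add_right)
      also have "W (W (y v)) + R (y v) = 0"
        by (simp add: y_def adjoint_pair_diff[OF W(1)] adjoint_pair_diff[OF saR] sq RW)
      finally show ?thesis by (simp add: ip.zero_right)
    qed
    have "W (y v) = 0" for v by (rule ip_sum_zero[OF sum_zero])
    moreover have "Q (y v) = 0" for v
      by (rule ip_sum_zero[of _ "W (y v)"]) (simp add: add.commute[of "ip (Q (y v)) (Q (y v))"] sum_zero)
    ultimately have "y (y x) = 0"
      using adjoint_pair_zero[OF W(1)] adjoint_pair_zero[OF adjoint_pair_sym[OF Q(1)]]
      by (simp add: y_def[of "y x"] Q(2))
    moreover have "ip (y x) (y x) = ip x (y (y x))"
    proof -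
      have "ip (y a) b = ip a (y b)" for a b
        by (simp add: y_def ip.diff_left ip.diff_right adjoint_pairD[OF W(1)] adjoint_pairD[OF saR])
      then show ?thesis .
    qed
    ultimately have "y x = 0" by (simp add: ip_definite ip.zero_right)
    then show ?thesis by (simp add: y_def)
  qed
  show ?thesis using eq[OF R] eq[OF R2] by auto
qed

lemma op_abs_eqI:
  assumes T: "adjoint_pair T T'" and R: "op_positive ip R" "R \<circ> R = T' \<circ> T"
  shows "op_abs ip T = R"
  unfolding op_abs_def op_sqrt_def adj_eq[OF T]
  using positive_square_root_unique[OF T] R by (intro the_equality) auto

lemma
  assumes T: "adjoint_pair T T'"
  shows op_abs_positive: "op_positive ip (op_abs ip T)"
    and op_abs_square: "op_abs ip T (op_abs ip T x) = T' (T x)"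
proof -
  obtain W where W: "adjoint_pair W W" "(W \<circ> W) \<circ> (W \<circ> W) = T' \<circ> T"
    using positive_root_exists[OF T] by metis
  have eq: "op_abs ip T = W \<circ> W" by (rule op_abs_eqI[OF T op_positive_square[OF W(1)] W(2)])
  show "op_positive ip (op_abs ip T)" unfolding eq by (rule op_positive_square[OF W(1)])
  show "op_abs ip T (op_abs ip T x) = T' (T x)"
    unfolding eq using fun_cong[OF W(2), of x] by simp
qed

text \<open>If \<open>W\<close> is the fourth root of \<open>B\<close>, then \<open>A\<close> commutes with \<open>W\<close>, and \<open>A B = W\<^sup>2 A W\<^sup>2\<close>.\<close>

lemma op_positive_commuting_product:
  assumes A: "op_positive ip A" and B: "op_positive ip B" and comm: "A \<circ> B = B \<circ> A"
  shows "op_positive ip (A \<circ> B)"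
proof -
  obtain Q Q' where Q: "adjoint_pair Q Q'" "B = Q' \<circ> Q" using B op_positive_iff by blast
  obtain W where W: "adjoint_pair W W" "(W \<circ> W) \<circ> (W \<circ> W) = Q' \<circ> Q"
    "\<And>C C'. adjoint_pair C C' \<Longrightarrow> C \<circ> (Q' \<circ> Q) = (Q' \<circ> Q) \<circ> C \<Longrightarrow> C \<circ> W = W \<circ> C"
    using positive_root_exists[OF Q(1)] by blast
  have "A \<circ> W = W \<circ> A" by (rule W(3)[OF op_positive_selfadjoint[OF A] comm[unfolded Q(2)]])
  then have AW: "A (W x) = W (A x)" for x by (simp add: fun_eq_iff)
  have "A \<circ> B = (W \<circ> W) \<circ> A \<circ> (W \<circ> W)"
    unfolding Q(2) W(2)[symmetric] by (simp add: AW fun_eq_iff)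
  with op_positive_conj[OF A adjoint_pair_comp[OF W(1) W(1)]] show ?thesis by simp
qed

lemma absorb_projection:
  assumes A: "adjoint_pair A A" and P: "adjoint_pair P P" and AAP: "\<And>x. A (A (x - P x)) = 0"
  shows "A (P x) = A x" and "P (A x) = A x"
proof -
  have right: "A (P x) = A x" for x
  proof -
    have "ip (A (x - P x)) (A (x - P x)) = ip (x - P x) (A (A (x - P x)))"
      by (rule adjoint_pairD[OF A])
    then have "A (x - P x) = 0" by (simp add: AAP ip_definite ip.zero_right)
    then show ?thesis by (simp add: adjoint_pair_diff[OF A])
  qed
  show "A (P x) = A x" by (rule right)
  show "P (A x) = A x"
    by (rule ip_eqI) (metis adjoint_pairD[OF A] adjoint_pairD[OF P] right)
qed

text \<open>If \<open>P\<close> projects along the kernel of \<open>A\<close>, then an operator \<open>C\<close> commuting with \<open>A\<close> preserves that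
  kernel, so \<open>P C = P C P\<close>. Taking adjoints gives \<open>C P = P C P\<close>. Working with kernels avoids approximating
  by elements of the range.\<close>

lemma commute_projection:
  assumes P: "adjoint_pair P P" and C: "adjoint_pair C C" and A: "adjoint_pair A A"
    and AP: "\<And>x. A (P x) = A x" and ker: "\<And>x. A x = 0 \<Longrightarrow> P x = 0"
    and AC: "\<And>x. A (C x) = C (A x)"
  shows "P (C x) = C (P x)"
proof -
  have PCP: "P (C (P x)) = P (C x)" for x
  proof -
    have "A (C (x - P x)) = 0"
      by (simp add: AC adjoint_pair_diff[OF A] AP adjoint_pair_zero[OF C])
    from ker[OF this] show ?thesis by (simp add: adjoint_pair_diff[OF C] adjoint_pair_diff[OF P])
  qed
  show ?thesis
    by (rule ip_eqI) (metis adjoint_pairD[OF C] adjoint_pairD[OF P] PCP)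
qed

lemma ortho_closure: "ortho ip (closure M) = ortho ip M"
proof
  show "ortho ip (closure M) \<subseteq> ortho ip M" using closure_subset by (auto simp: ortho_def)
  show "ortho ip M \<subseteq> ortho ip (closure M)"
  proof
    fix y assume "y \<in> ortho ip M"
    then have "M \<subseteq> {x. ip x y = 0}" by (auto simp: ortho_def)
    moreover have "closed {x. ip x y = 0}"
      by (intro closed_Collect_eq ip.continuous_on continuous_on_id continuous_on_const)
    ultimately have "closure M \<subseteq> {x. ip x y = 0}" by (rule closure_minimal)
    then show "y \<in> ortho ip (closure M)" by (auto simp: ortho_def)
  qed
qed

end

section \<open>Polar decompositions\<close>

text \<open>A polar decomposition freed from definite descriptions, except for the absolute value. Since \<open>U' U\<close> is
  self-adjoint, the last two assumptions make it the projection onto the closed range of \<open>T'\<close>.\<close>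

locale polar = hilbert_module ip act
  for ip :: "'h::complex_banach \<Rightarrow> 'h \<Rightarrow> 'a::c_star_algebra" and act +
  fixes T T' U U' A :: "'h \<Rightarrow> 'h"
  assumes adj_T: "adjoint_pair T T'" and adj_U: "adjoint_pair U U'"
    and A_eq: "A = op_abs ip T" and T_eq: "T x = U (A x)"
    and init_range: "U' (U x) \<in> closure (range T')"
    and init_fixes: "x \<in> closure (range T') \<Longrightarrow> U' (U x) = x"
begin

lemmas sym_T = adjoint_pair_sym[OF adj_T] and sym_U = adjoint_pair_sym[OF adj_U]

lemma sa_init: "adjoint_pair (\<lambda>x. U' (U x)) (\<lambda>x. U' (U x))"
  using adjoint_pair_comp[OF sym_U adj_U] by (simp add: comp_def)

lemma pos_A: "op_positive ip A" and A_square: "A (A x) = T' (T x)"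
  unfolding A_eq by (rule op_abs_positive[OF adj_T], rule op_abs_square[OF adj_T])

lemma sa_A: "adjoint_pair A A"
  by (rule op_positive_selfadjoint[OF pos_A])

lemma init_idem: "U' (U (U' (U x))) = U' (U x)"
  by (intro init_fixes init_range)

lemma T_init: "T (U' (U x)) = T x"
proof (rule ip_eqI)
  fix z
  have "U' (U (T' z)) = T' z" by (rule init_fixes[OF subsetD[OF closure_subset rangeI]])
  then show "ip z (T (U' (U x))) = ip z (T x)"
    by (metis adjoint_pairD[OF sym_T] adjoint_pairD[OF sa_init])
qed

lemma A_init: "A (U' (U x)) = A x" and init_A: "U' (U (A x)) = A x"
proof -
  have "A (A (x - U' (U x))) = 0" for x
    by (simp add: A_square adjoint_pair_diff[OF adj_T] T_init adjoint_pair_zero[OF sym_T])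
  from absorb_projection[OF sa_A sa_init this]
  show "A (U' (U x)) = A x" "U' (U (A x)) = A x" .
qed

lemma init_kernel:
  assumes "A x = 0"
  shows "U' (U x) = 0"
proof -
  have "T x = 0" using assms T_eq adjoint_pair_zero[OF adj_U] by simp
  then have "x \<in> ortho ip (range T')"
    by (auto simp: ortho_def adjoint_pairD[OF sym_T] ip.zero_right)
  then have "x \<in> ortho ip (closure (range T'))" by (simp only: ortho_closure)
  then have x: "ip y x = 0" if "y \<in> closure (range T')" for y
    using that by (simp add: ortho_def)
  have "ip (U' (U x)) (U' (U x)) = ip (U' (U (U' (U x)))) x" by (rule adjoint_pairD[OF sa_init, symmetric])
  also have "\<dots> = 0" by (intro x init_range)
  finally show ?thesis by (rule ip_definite)
qed

lemma U_init: "U (U' (U x)) = U x"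
proof -
  let ?w = "U' (U x) - x"
  have "ip (U ?w) (U ?w) = ip ?w (U' (U ?w))" by (rule adjoint_pairD[OF adj_U])
  also have "U' (U ?w) = 0"
    using init_idem by (simp add: adjoint_pair_diff[OF adj_U] adjoint_pair_diff[OF sym_U])
  finally have "U ?w = 0" by (simp add: ip_definite ip.zero_right)
  then show ?thesis by (simp add: adjoint_pair_diff[OF adj_U])
qed

lemma adjoint_U_fin: "U' (U (U' x)) = U' x"
proof (rule ip_eqI)
  fix z
  have "ip z (U' (U (U' x))) = ip (U (U' (U z))) x"
    by (simp only: adjoint_pairD[OF adj_U] adjoint_pairD[OF sa_init])
  then show "ip z (U' (U (U' x))) = ip z (U' x)"
    by (simp only: U_init adjoint_pairD[OF adj_U])
qed

lemma adjoint_T_eq: "T' x = A (U' x)"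
  by (rule ip_eqI) (metis adjoint_pairD[OF adj_T] adjoint_pairD[OF adj_U] adjoint_pairD[OF sa_A] T_eq)

text \<open>The operator \<open>U A U'\<close> is positive and squares to \<open>T T'\<close>, so uniqueness of the root applies.\<close>

lemma op_abs_adjoint: "op_abs ip T' x = U (A (U' x))"
proof -
  have "op_abs ip T' = U \<circ> A \<circ> U'"
  proof (rule op_abs_eqI[OF sym_T])
    show "op_positive ip (U \<circ> A \<circ> U')" by (rule op_positive_conj[OF pos_A sym_U])
    show "(U \<circ> A \<circ> U') \<circ> (U \<circ> A \<circ> U') = T \<circ> T'"
      by (simp add: fun_eq_iff init_A T_eq adjoint_T_eq)
  qed
  then show ?thesis by simp
qed

end

context hilbert_module
begin

lemma polar_of_polar_decomposition:
  assumes "T \<in> adjointable ip" and pd: "polar_decomposition ip act U T"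
  shows "polar ip act T (adj ip T) U (adj ip U) (op_abs ip T)"
proof -
  let ?M = "closure (range (adj ip T))"
  have U: "U \<in> adjointable ip" and T: "T = U \<circ> op_abs ip T"
    and M: "orth_complemented ip act ?M" and proj: "adj ip U \<circ> U = proj_onto ip ?M"
    using pd by (auto simp: polar_decomposition_def partial_isometry_def)
  have diff: "m - m' \<in> ?M" if "m \<in> ?M" "m' \<in> ?M" for m m'
  proof -
    have "m + (-1) *\<^sub>C m' \<in> ?M" using M that unfolding orth_complemented_def closed_submodule_def by blast
    then show ?thesis by (simp add: scaleC_minus1)
  qed
  have proj_eq: "proj_onto ip ?M x = m" if m: "m \<in> ?M" "x - m \<in> ortho ip ?M" for x m
    unfolding proj_onto_def
  proof (rule the_equality)
    fix m' assume m': "m' \<in> ?M \<and> x - m' \<in> ortho ip ?M"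
    have "m' - m = (x - m) - (x - m')" by simp
    also have "\<dots> \<in> ortho ip ?M" using m m' by (simp add: ortho_def ip.diff_right)
    finally have "m' - m \<in> ?M \<inter> ortho ip ?M" using diff m m' by blast
    also have "\<dots> = {0}" using M by (simp add: orth_complemented_def)
    finally show "m' = m" by simp
  qed (use m in simp)
  show ?thesis
  proof unfold_locales
    show "adjoint_pair T (adj ip T)" "adjoint_pair U (adj ip U)"
      by (intro adjointable_adj U assms)+
    show "T x = U (op_abs ip T x)" for x using fun_cong[OF T, of x] by simp
    show "adj ip U (U x) \<in> ?M" for x
    proof -
      obtain m n where mn: "m \<in> ?M" "n \<in> ortho ip ?M" "x = m + n"
        using M unfolding orth_complemented_def by blast
      then have "proj_onto ip ?M x = m" by (intro proj_eq) auto
      then show ?thesis using fun_cong[OF proj, of x] mn(1) by simp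
    qed
    show "adj ip U (U x) = x" if "x \<in> ?M" for x
      using proj_eq[of x x] that fun_cong[OF proj, of x] by (simp add: ortho_def ip.zero_right)
  qed simp
qed

text \<open>The closed range of \<open>T'\<close> is the set of fixed points of the self-adjoint idempotent \<open>U' U\<close>, and such
  a set is always an orthogonally complemented closed submodule.\<close>

lemma polar_decompositionI:
  assumes T: "adjoint_pair T T'" and U: "adjoint_pair U U'" and eq: "T = U \<circ> op_abs ip T"
    and range: "\<And>x. U' (U x) \<in> closure (range T')"
    and fixed: "\<And>x. x \<in> closure (range T') \<Longrightarrow> U' (U x) = x"
  shows "polar_decomposition ip act U T"
proof -
  let ?P = "U' \<circ> U" and ?M = "closure (range T')"
  have P: "adjoint_pair ?P ?P" by (rule adjoint_pair_comp[OF adjoint_pair_sym[OF U] U])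
  have PP: "?P (?P x) = ?P x" for x using fixed[OF range] by simp
  have M: "?M = {x. ?P x = x}" using range fixed by auto (metis range)
  have compl: "x - ?P x \<in> ortho ip ?M" for x
    unfolding ortho_def
  proof clarify
    fix m assume "m \<in> ?M"
    then have "?P m = m" by (simp add: M)
    then have "ip m (?P x) = ip m x" using adjoint_pairD[OF P, of m x] by metis
    then show "ip m (x - ?P x) = 0" by (simp add: ip.diff_right)
  qed
  have sub: "closed_submodule act ?M"
    unfolding closed_submodule_def
  proof (intro conjI)
    show "closed ?M" by simp
  qed (auto simp: M adjoint_pair_zero[OF P, simplified] adjoint_pair_add[OF P, simplified]
      adjoint_pair_scaleC[OF P, simplified] adjoint_pair_act[OF P, simplified])
  have inter: "?M \<inter> ortho ip ?M = {0}"
    using sub ip_definite by (auto simp: ortho_def closed_submodule_def ip.zero_right)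
  have oc: "orth_complemented ip act ?M"
    unfolding orth_complemented_def
  proof (intro conjI sub inter allI)
    fix x
    show "\<exists>m\<in>?M. \<exists>n\<in>ortho ip ?M. x = m + n"
      using compl[of x] range[of x] by (intro bexI[of _ "?P x"] bexI[of _ "x - ?P x"]) auto
  qed
  have proj: "?P = proj_onto ip ?M"
  proof
    fix x
    show "?P x = proj_onto ip ?M x"
      unfolding proj_onto_def
    proof (rule the_equality[symmetric])
      show "?P x \<in> ?M \<and> x - ?P x \<in> ortho ip ?M" using compl range by simp
      fix m assume m: "m \<in> ?M \<and> x - m \<in> ortho ip ?M"
      have "ip (?P z) (x - m) = 0" for z
        using m range[of z] by (auto simp: ortho_def)
      then have "ip z (?P (x - m)) = 0" for z by (simp only: adjoint_pairD[OF P])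
      then have "?P (x - m) = 0" using ip_definite by blast
      then have "?P x = ?P m" by (simp add: adjoint_pair_diff[OF P, simplified])
      then show "m = ?P x" using m by (simp add: M)
    qed
  qed
  have "op_projection ip ?P"
    using P adjointable_iff adj_eq[OF P] PP by (auto simp: op_projection_def)
  then have "partial_isometry ip U"
    using U adjointable_iff adj_eq[OF U] by (auto simp: partial_isometry_def)
  then show ?thesis
    using eq oc proj by (simp add: polar_decomposition_def adj_eq[OF T] adj_eq[OF U])
qed

end

section \<open>The polar decomposition of a product\<close>

text \<open>In the comments \<open>P = U' U\<close> is the initial projection of \<open>U\<close> and \<open>F = V V'\<close> the final projection of
  \<open>V\<close>. The roles of \<open>A\<close> and \<open>D\<close> are those of the absolute values of \<open>T\<close> and \<open>S\<close>; the operator \<open>B\<close> below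
  is the absolute value of \<open>S'\<close>.\<close>

locale polar_pair = T: polar ip act T T' U U' A + S: polar ip act S S' V V' D
  for ip :: "'h::complex_banach \<Rightarrow> 'h \<Rightarrow> 'a::c_star_algebra" and act
    and T T' U U' A S S' V V' D
begin

definition B :: "'h \<Rightarrow> 'h" where "B = op_abs ip S'"

lemma B_eq: "B x = V (D (V' x))"
  by (simp add: B_def S.op_abs_adjoint)

lemma pos_B: "op_positive ip B"
  unfolding B_def by (rule T.op_abs_positive[OF S.sym_T])

lemma sa_B: "T.adjoint_pair B B"
  by (rule T.op_positive_selfadjoint[OF pos_B])

lemma S_eq_B: "S x = B (V x)"
  by (simp add: B_eq S.A_init S.T_eq)

lemma adjoint_S_eq_B: "S' x = V' (B x)"
  by (simp add: B_eq S.init_A S.adjoint_T_eq)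

lemma S_V': "S (V' x) = B x" and V_S': "V (S' x) = B x"
  by (simp_all add: B_eq S.T_eq S.adjoint_T_eq)

lemma B_fin: "B (V (V' x)) = B x"
  by (simp add: B_eq S.adjoint_U_fin)

text \<open>So \<open>F\<close> projects along the kernel of \<open>B\<close>.\<close>

lemma fin_kernel: "B x = 0 \<Longrightarrow> V (V' x) = 0"
proof -
  assume "B x = 0"
  then have "V' (V (D (V' x))) = 0" by (simp add: B_eq T.adjoint_pair_zero[OF S.sym_U])
  then have "D (V' x) = 0" by (simp add: S.init_A)
  then have "V' (V (V' x)) = 0" by (rule S.init_kernel)
  then show ?thesis by (simp add: S.adjoint_U_fin T.adjoint_pair_zero[OF S.adj_U])
qed

lemma sa_fin: "T.adjoint_pair (\<lambda>x. V (V' x)) (\<lambda>x. V (V' x))"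
  using T.adjoint_pair_comp[OF S.adj_U S.sym_U] by (simp add: comp_def)

lemma adj_TS: "T.adjoint_pair (T \<circ> S) (S' \<circ> T')"
  by (rule T.adjoint_pair_comp[OF T.adj_T S.adj_T])

text \<open>If \<open>A\<close> and \<open>B\<close> commute, so do \<open>P\<close> and \<open>F\<close> with each other and with \<open>A\<close> and \<open>B\<close>. Then \<open>V' A B V\<close> is positive
  with square \<open>V' B A\<^sup>2 B V = (T S)' (T S)\<close>, which identifies it as the absolute value of \<open>T S\<close>. What remains
  is that \<open>G = (U V)' (U V) = V' P V\<close> projects onto the closed range of \<open>S' T'\<close>. It fixes this range
  since \<open>V' P V S' T' = V' P B T' = V' B P T' = S' T'\<close>. It maps into it by two density
  steps: \<open>S' P\<close> does, as \<open>P\<close> maps into the closed range of \<open>T'\<close>; hence \<open>G S' = V' P B = S' P\<close> does,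
  and \<open>G = G V' V\<close> where \<open>V' V\<close> maps into the closed range of \<open>S'\<close>.\<close>

lemma polar_decomposition_if_commute:
  assumes "A \<circ> B = B \<circ> A"
  shows "polar_decomposition ip act (U \<circ> V) (T \<circ> S)"
proof -
  have AB: "A (B x) = B (A x)" for x using fun_cong[OF assms, of x] by simp
  have FA: "V (V' (A x)) = A (V (V' x))" for x
    by (rule T.commute_projection[OF sa_fin T.sa_A sa_B B_fin fin_kernel AB[symmetric]])
  have PB: "U' (U (B x)) = B (U' (U x))" for x
    by (rule T.commute_projection[OF T.sa_init sa_B T.sa_A T.A_init T.init_kernel AB])
  have FP: "V (V' (U' (U x))) = U' (U (V (V' x)))" for x
    by (rule T.commute_projection[OF sa_fin T.sa_init sa_B B_fin fin_kernel PB[symmetric]])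
  have abs: "op_abs ip (T \<circ> S) = V' \<circ> (A \<circ> B) \<circ> V"
  proof (rule T.op_abs_eqI[OF adj_TS])
    show "op_positive ip (V' \<circ> (A \<circ> B) \<circ> V)"
      by (intro T.op_positive_conj T.op_positive_commuting_product T.pos_A pos_B assms S.adj_U)
    show "(V' \<circ> (A \<circ> B) \<circ> V) \<circ> (V' \<circ> (A \<circ> B) \<circ> V) = (S' \<circ> T') \<circ> (T \<circ> S)"
    proof
      fix x
      have "((V' \<circ> (A \<circ> B) \<circ> V) \<circ> (V' \<circ> (A \<circ> B) \<circ> V)) x = V' (A (B (V (V' (A (B (V x)))))))"
        by simp
      also have "\<dots> = V' (B (A (A (B (V x)))))"
        by (simp only: FA[symmetric] AB[symmetric] B_fin)
      also have "\<dots> = ((S' \<circ> T') \<circ> (T \<circ> S)) x"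
        by (simp add: T.A_square S_eq_B adjoint_S_eq_B)
      finally show "((V' \<circ> (A \<circ> B) \<circ> V) \<circ> (V' \<circ> (A \<circ> B) \<circ> V)) x = ((S' \<circ> T') \<circ> (T \<circ> S)) x" .
    qed
  qed
  let ?K = "closure (range (S' \<circ> T'))"
  have adj_UV: "T.adjoint_pair (U \<circ> V) (V' \<circ> U')" by (rule T.adjoint_pair_comp[OF T.adj_U S.adj_U])
  have fin_B: "V (V' (B x)) = B x" for x by (simp add: B_eq S.U_init)
  show ?thesis
  proof (rule T.polar_decompositionI[OF adj_TS adj_UV])
    show "T \<circ> S = U \<circ> V \<circ> op_abs ip (T \<circ> S)"
      by (simp add: abs fun_eq_iff FA fin_B T.T_eq S_eq_B)
    fix x
    \<comment> \<open>First density step, for the range of \<open>T'\<close>.\<close>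
    have SP: "S' (U' (U y)) \<in> ?K" for y
    proof -
      have "S' (U' (U y)) \<in> S' ` closure (range T')" using T.init_range by blast
      also have "\<dots> \<subseteq> closure (S' ` range T')"
        by (rule image_closure_subset[OF T.adjoint_pair_continuous[OF S.sym_T] closed_closure closure_subset])
      also have "S' ` range T' = range (S' \<circ> T')" by auto
      finally show ?thesis .
    qed
    let ?G = "(V' \<circ> U') \<circ> (U \<circ> V)"
    have adj_G: "T.adjoint_pair ?G ?G" by (rule T.adjoint_pair_comp[OF T.adjoint_pair_sym[OF adj_UV] adj_UV])
    \<comment> \<open>Second density step, for the range of \<open>S'\<close>.\<close>
    have "?G ` range S' \<subseteq> ?K"
    proof clarify
      fix y
      have "?G (S' y) = S' (U' (U y))" by (simp add: adjoint_S_eq_B fin_B PB)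
      then show "?G (S' y) \<in> ?K" using SP by metis
    qed
    then have "?G ` closure (range S') \<subseteq> ?K"
      by (rule image_closure_subset[OF T.adjoint_pair_continuous[OF adj_G] closed_closure])
    then have "?G (V' (V x)) \<in> ?K" using S.init_range by blast
    then show "(V' \<circ> U') ((U \<circ> V) x) \<in> ?K" by (simp add: S.U_init)
    have "range (S' \<circ> T') \<subseteq> {x. ?G x = x}"
      by (auto simp: adjoint_S_eq_B fin_B PB T.adjoint_T_eq T.init_A)
    moreover have "closed {x. ?G x = x}"
      by (intro closed_Collect_eq T.adjoint_pair_continuous[OF adj_G] continuous_on_id)
    ultimately have "?K \<subseteq> {x. ?G x = x}" by (rule closure_minimal)
    then show "x \<in> ?K \<Longrightarrow> (V' \<circ> U') ((U \<circ> V) x) = x" by auto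
  qed
qed

text \<open>Let \<open>N\<close> be the absolute value of \<open>T S\<close> and \<open>E = V N V'\<close>. The factorization gives \<open>P E = A B\<close>, and
  \<open>E\<^sup>2 = V N\<^sup>2 V' = B A\<^sup>2 B = (A B)' (A B) = E P E\<close>. So \<open>E (1 - P) E = 0\<close>, that is, \<open>E = P E = A B\<close>. Thus \<open>A B\<close> is
  self-adjoint.\<close>

lemma commute_if_factorization:
  assumes "T \<circ> S = U \<circ> V \<circ> op_abs ip (T \<circ> S)"
  shows "A \<circ> B = B \<circ> A"
proof -
  define N where "N = op_abs ip (T \<circ> S)"
  have TS: "T (S x) = U (V (N x))" for x using fun_cong[OF assms, of x] by (simp add: N_def)
  have sa_N: "T.adjoint_pair N N"
    unfolding N_def by (rule T.op_positive_selfadjoint[OF T.op_abs_positive[OF adj_TS]])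
  have NN: "N (N x) = S' (T' (T (S x)))" for x
    unfolding N_def using T.op_abs_square[OF adj_TS, of x] by simp
  have "N (N (x - V' (V x))) = 0" for x
    by (simp add: NN T.adjoint_pair_diff[OF S.adj_T] S.T_init T.adjoint_pair_zero[OF T.adj_T]
        T.adjoint_pair_zero[OF T.sym_T] T.adjoint_pair_zero[OF S.sym_T])
  note init_N = T.absorb_projection(2)[OF sa_N S.sa_init this]
  define E where "E = V \<circ> N \<circ> V'"
  have sa_E: "T.adjoint_pair E E"
    using T.adjoint_pair_comp[OF T.adjoint_pair_comp[OF S.adj_U sa_N] S.sym_U]
    by (simp add: E_def comp_assoc)
  have PE: "U' (U (E x)) = A (B x)" for x
  proof -
    have "U (E x) = U (A (B x))" using TS[of "V' x"] by (simp add: E_def S_V' T.T_eq)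
    then show ?thesis by (simp add: T.init_A)
  qed
  have EE: "E (E x) = B (A (A (B x)))" for x
    by (simp add: E_def init_N NN S_V' V_S' T.A_square)
  have E_eq: "E x = A (B x)" for x
  proof -
    let ?w = "E x - U' (U (E x))"
    have "ip (E x) (E x) = ip x (E (E x))" by (rule T.adjoint_pairD[OF sa_E])
    also have "\<dots> = ip (A (B x)) (A (B x))"
      by (simp add: EE T.adjoint_pairD[OF sa_B] T.adjoint_pairD[OF T.sa_A])
    also have "\<dots> = ip (E x) (U' (U (E x)))"
      using T.adjoint_pairD[OF T.sa_init, of "E x" "U' (U (E x))"] by (simp add: T.init_idem flip: PE)
    finally have 1: "ip (E x) ?w = 0" by (simp add: T.ip.diff_right)
    have "U' (U ?w) = 0"
      by (simp add: T.adjoint_pair_diff[OF T.adj_U] T.adjoint_pair_diff[OF T.sym_U] T.init_idem)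
    then have "ip (U' (U (E x))) ?w = 0"
      using T.adjoint_pairD[OF T.sa_init, of "E x" ?w] by (simp add: T.ip.zero_right)
    with 1 have "ip ?w ?w = 0" using T.ip.diff_left[of "E x" "U' (U (E x))" ?w] by simp
    then have "?w = 0" by (rule T.ip_definite)
    then show ?thesis by (simp add: PE)
  qed
  have "A (B x) = B (A x)" for x
  proof (rule T.ip_eqI)
    fix z
    have "ip z (A (B x)) = ip (A (B z)) x"
      using T.adjoint_pairD[OF sa_E, of z x] by (simp add: E_eq)
    then show "ip z (A (B x)) = ip z (B (A x))"
      by (simp add: T.adjoint_pairD[OF T.sa_A] T.adjoint_pairD[OF sa_B])
  qed
  then show ?thesis by auto
qed

end

theorem theorem3p5:
  fixes ip :: "'h::complex_banach \<Rightarrow> 'h \<Rightarrow> 'a::c_star_algebra"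
    and act :: "'h \<Rightarrow> 'a \<Rightarrow> 'h"
    and T S U V :: "'h \<Rightarrow> 'h"
  assumes "hilbert_module ip act"
    and "T \<in> adjointable ip" and "S \<in> adjointable ip"
    and "polar_decomposition ip act U T"
    and "polar_decomposition ip act V S"
  shows "(op_abs ip T \<circ> op_abs ip (adj ip S) = op_abs ip (adj ip S) \<circ> op_abs ip T
            \<longleftrightarrow> polar_decomposition ip act (U \<circ> V) (T \<circ> S))
       \<and> (polar_decomposition ip act (U \<circ> V) (T \<circ> S)
            \<longleftrightarrow> T \<circ> S = U \<circ> V \<circ> op_abs ip (T \<circ> S))"
proof -
  interpret hilbert_module ip act by (rule assms(1))
  interpret polar_pair ip act T "adj ip T" U "adj ip U" "op_abs ip T" S "adj ip S" V "adj ip V" "op_abs ip S"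
    by (intro polar_pair.intro polar_of_polar_decomposition assms)
  have "polar_decomposition ip act (U \<circ> V) (T \<circ> S) \<Longrightarrow> T \<circ> S = U \<circ> V \<circ> op_abs ip (T \<circ> S)"
    by (simp add: polar_decomposition_def)
  then show ?thesis
    using polar_decomposition_if_commute commute_if_factorization unfolding B_def by blast
qed

end
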